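(* Let $n\ge 3$ and let $T$ be a star-like tree: a tree with a central vertex $c$ of degree $n$ such that $T$ is the union of $n$ paths (branches) meeting only at $c$, each branch starting at $c$ and having length at least $2$. Let $V$ be the vertex set of $T$, let $P=\{(0,\infty),(1,4)\}$, and let $$\mathbf{data}_P=\{z\in\mathbb{R}^V:\mathrm{PH}_0(z)=P\}.$$ Then $\mathbf{data}_P$ is homotopy equivalent to a bouquet (wedge) of $n^2-3n+1$ circles.
   Context: A vector $z\in\mathbb{R}^V$ is viewed as a function on vertices, extended to edges by taking the maximum over the two endpoints. For $r\in\mathbb{R}$, $T_r(z)$ is the subcomplex consisting of vertices $v$ with $z_v\le r$ and edges $[v,w]$ with $\max\{z_v,z_w\}\le r$. $\mathrm{PH}_0(z)$ is the degree-$0$ persistence diagram (multiset of (birth, death) pairs, death possibly $\infty$) of the sublevel-set filtration $r\mapsto T_r(z)$. $\mathbf{data}_P$ has the subspace topology of $\mathbb{R}^V$. *)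

theory Defs
  imports "HOL-Analysis.Analysis"
begin

definition star_like_tree :: "('v::finite) set set \<Rightarrow> nat \<Rightarrow> bool" where
  "star_like_tree E n \<longleftrightarrow>
     (\<exists>c ps. length ps = n \<and>
        (\<forall>p\<in>set ps. distinct p \<and> length p \<ge> 3 \<and> hd p = c) \<and>
        (\<forall>i<n. \<forall>j<n. i \<noteq> j \<longrightarrow> set (ps!i) \<inter> set (ps!j) = {c}) \<and>
        (\<Union>p\<in>set ps. set p) = UNIV \<and>
        E = (\<Union>p\<in>set ps. {{p!k, p!(k+1)} | k. k + 1 < length p}))"

text \<open>Number of connected components of the subgraph induced on S (vertices in S,
  edges with both endpoints in S) that contain a vertex of A.  For A = T_r, S = T_s
  (r \<le> s) this is the rank of H_0(T_r) \<rightarrow> H_0(T_s).\<close>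
definition comp_count :: "'v set set \<Rightarrow> 'v set \<Rightarrow> 'v set \<Rightarrow> nat" where
  "comp_count E A S =
     card ((\<lambda>v. {w \<in> S. (\<lambda>a b. a \<in> S \<and> b \<in> S \<and> {a, b} \<in> E)\<^sup>*\<^sup>* v w}) ` A)"

text \<open>Vertex set of the sublevel complex T_r(z) (edges of T_r are exactly those with both
  endpoints in it), and of T_{r-\<epsilon>} for \<epsilon> small (= strict sublevel set).\<close>
definition sub_le :: "real^'v \<Rightarrow> real \<Rightarrow> 'v set" where
  "sub_le z r = {v. z $ v \<le> r}"

definition sub_lt :: "real^'v \<Rightarrow> real \<Rightarrow> 'v set" where
  "sub_lt z r = {v. z $ v < r}"

text \<open>Degree-0 persistence diagram of the sublevel-set filtration, as a multiplicity
  function on (birth, death) pairs, death in ereal (\<infinity> = never dies), computed from the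
  rank function by the standard inclusion-exclusion formula (bars [b,d), b < d).\<close>
definition ph0 :: "'v set set \<Rightarrow> real^'v \<Rightarrow> real \<times> ereal \<Rightarrow> int" where
  "ph0 E z p = (case p of
     (b, PInfty) \<Rightarrow> int (comp_count E (sub_le z b) UNIV) - int (comp_count E (sub_lt z b) UNIV)
   | (b, ereal d) \<Rightarrow> (if b < d then
        int (comp_count E (sub_le z b) (sub_lt z d)) - int (comp_count E (sub_lt z b) (sub_lt z d))
      - int (comp_count E (sub_le z b) (sub_le z d)) + int (comp_count E (sub_lt z b) (sub_le z d))
      else 0)
   | (b, MInfty) \<Rightarrow> 0)"

definition PH0_eq :: "'v set set \<Rightarrow> real^'v \<Rightarrow> (real \<times> ereal) multiset \<Rightarrow> bool" where
  "PH0_eq E z P \<longleftrightarrow> (\<forall>p. ph0 E z p = int (count P p))"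

definition data :: "'v set set \<Rightarrow> (real \<times> ereal) multiset \<Rightarrow> (real^'v) set" where
  "data E P = {z. PH0_eq E z P}"

text \<open>Bouquet of k circles: the circles |x - j| = j, j = 1..k, in the complex plane,
  pairwise meeting only at 0.\<close>
definition bouquet :: "nat \<Rightarrow> complex set" where
  "bouquet k = (\<Union>j\<in>{1..k}. sphere (of_nat j) (of_nat j))"

end

theory Submission
  imports Defs
begin

text \<open>
  A vector \<open>z\<close> has the diagram \<open>{(\<alpha>, \<infinity>), (\<beta>, \<gamma>)}\<close> iff it has a well of value \<open>\<alpha>\<close> at some vertex \<open>a\<close>, a
  well of value \<open>\<beta>\<close> at some \<open>b\<close>, a peak of value \<open>\<gamma>\<close> at some \<open>p\<close> on the path between them, and is otherwise
  monotone towards one of the wells. For fixed \<open>(a, p, b)\<close> this is a closed convex cell, and the cells with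
  peak \<open>p\<close> and the wells in prescribed components of \<open>T - p\<close> share a point, so that their union is an
  absolute retract. Sliding the peak along a branch glues these unions along absolute retracts. One obtains
  sets \<open>W\<^sub>i\<close> (peak on branch \<open>i\<close>, the deep well beyond it) and \<open>U\<^sub>j\<close> (the shallow well beyond the peak on
  branch \<open>j\<close>, or the peak at the centre and the shallow well on branch \<open>j\<close>). They cover the space, each family
  is pairwise disjoint, and \<open>U\<^sub>j \<inter> W\<^sub>i\<close> is an absolute retract for \<open>i \<noteq> j\<close> and empty for \<open>i = j\<close>. The nerve
  is thus the complete bipartite graph on \<open>n + n\<close> vertices minus a perfect matching, whose cycle rank is
  \<open>n(n - 1) - 2n + 1 = n\<^sup>2 - 3n + 1\<close>. Since maps into absolute retracts extend from closed subsets, closed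
  covers by absolute retracts with the same nerve have homotopy equivalent unions, and a union whose nerve is
  a connected graph is homotopy equivalent to a bouquet of as many circles as its cycle rank.
\<close>

section \<open>Unions of absolute retracts\<close>

lemma AR_UN_convex_common_point:
  fixes C :: "'i \<Rightarrow> 'a::euclidean_space set"
  assumes "finite I" "I \<noteq> {}" "\<And>i. i \<in> I \<Longrightarrow> closed (C i)" "\<And>i. i \<in> I \<Longrightarrow> convex (C i)"
    and "\<And>i. i \<in> I \<Longrightarrow> x \<in> C i"
  shows "AR (\<Union>i\<in>I. C i)"
  using assms
proof (induction I arbitrary: C rule: finite_ne_induct)
  case (singleton i)
  then show ?case by (auto intro: convex_imp_AR)
next
  case (insert k I)
  have "AR ((\<Union>i\<in>I. C i) \<union> C k)"
  proof (rule AR_closed_Un)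
    show "closed (\<Union>i\<in>I. C i)" using insert by (auto intro: closed_UN)
    show "AR (\<Union>i\<in>I. C i)" using insert by auto
    show "AR (C k)" by (rule convex_imp_AR) (use insert.prems in auto)
    have "AR (\<Union>i\<in>I. C i \<inter> C k)"
      by (rule insert.IH) (use insert.prems in \<open>auto intro: convex_Int\<close>)
    then show "AR ((\<Union>i\<in>I. C i) \<inter> C k)" by (simp only: Int_UN_distrib2 UN_simps)
  qed (use insert.prems in auto)
  then show ?case by (simp add: Un_commute)
qed

lemma AR_Un_UN_star:
  fixes Z :: "'i \<Rightarrow> 'a::euclidean_space set"
  assumes "finite I" "closed Y" "AR Y" "\<And>i. i \<in> I \<Longrightarrow> closed (Z i)" "\<And>i. i \<in> I \<Longrightarrow> AR (Z i)"
    and "\<And>i. i \<in> I \<Longrightarrow> AR (Y \<inter> Z i)"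
    and "\<And>i j. \<lbrakk>i \<in> I; j \<in> I; i \<noteq> j\<rbrakk> \<Longrightarrow> Z i \<inter> Z j \<subseteq> Y"
  shows "AR (Y \<union> (\<Union>i\<in>I. Z i))"
  using assms
proof (induction I rule: finite_induct)
  case (insert k I)
  have "AR ((Y \<union> (\<Union>i\<in>I. Z i)) \<union> Z k)"
  proof (rule AR_closed_Un)
    have "(Y \<union> (\<Union>i\<in>I. Z i)) \<inter> Z k = Y \<inter> Z k"
      using insert.prems(6)[of _ k] insert.hyps by fast
    then show "AR ((Y \<union> (\<Union>i\<in>I. Z i)) \<inter> Z k)" using insert.prems by simp
  qed (use insert in \<open>auto intro!: closed_UN closed_Un\<close>)
  then show ?case by (simp add: Un_ac)
qed auto

lemma AR_UN_chain:
  fixes V :: "nat \<Rightarrow> 'a::euclidean_space set"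
  assumes "a \<le> b" "\<And>m. m \<in> {a..b} \<Longrightarrow> closed (V m)" "\<And>m. m \<in> {a..b} \<Longrightarrow> AR (V m)"
    and "\<And>m. m \<in> {a..<b} \<Longrightarrow> AR (V m \<inter> V (Suc m))"
    and "\<And>l m. \<lbrakk>a \<le> l; l \<le> m; m < b\<rbrakk> \<Longrightarrow> V l \<inter> V (Suc m) \<subseteq> V m"
  shows "AR (\<Union>m\<in>{a..b}. V m)"
  using assms
proof (induction b rule: dec_induct)
  case (step b)
  have "AR ((\<Union>m\<in>{a..b}. V m) \<union> V (Suc b))"
  proof (rule AR_closed_Un)
    have "(\<Union>m\<in>{a..b}. V m) \<inter> V (Suc b) = V b \<inter> V (Suc b)"
      using step.prems(4)[of _ b] step.hyps by fastforce
    then show "AR ((\<Union>m\<in>{a..b}. V m) \<inter> V (Suc b))" using step by simp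
  qed (use step in \<open>auto intro!: closed_UN\<close>)
  then show ?case using step.hyps by (simp add: atLeastAtMostSuc_conv Un_commute)
qed auto

lemma AR_extension_closed_Un:
  fixes h :: "'a::euclidean_space \<Rightarrow> 'b::euclidean_space"
  assumes "closed D" "closed Y" "continuous_on D h" "h ` (D \<inter> Y) \<subseteq> T" "AR T"
  obtains g where "continuous_on (D \<union> Y) g" "\<And>x. x \<in> D \<Longrightarrow> g x = h x" "g ` Y \<subseteq> T"
proof -
  have "continuous_on (D \<inter> Y) h" using assms(3) continuous_on_subset by blast
  moreover have "closedin (top_of_set Y) (D \<inter> Y)"
    using closedin_closed_Int[OF assms(1), of Y] by (simp only: Int_commute)
  ultimately obtain k where k: "continuous_on Y k" "k ` Y \<subseteq> T" "\<And>x. x \<in> D \<inter> Y \<Longrightarrow> k x = h x"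
    using AR_imp_absolute_extensor[of T "D \<inter> Y" h Y] assms(4,5) by metis
  have "continuous_on (D \<union> Y) (\<lambda>x. if x \<in> D then h x else k x)"
    by (rule continuous_on_If) (use assms k in auto)
  then show ?thesis
    using that[of "\<lambda>x. if x \<in> D then h x else k x"] k(2,3) assms(4) by (auto simp: image_subset_iff)
qed

section \<open>Covers by absolute retracts and their nerves\<close>

definition nerve :: "'i set \<Rightarrow> ('i \<Rightarrow> 'a set) \<Rightarrow> 'i set set" where
  "nerve I X = {\<sigma>. \<sigma> \<subseteq> I \<and> \<sigma> \<noteq> {} \<and> (\<Inter>i\<in>\<sigma>. X i) \<noteq> {}}"

definition AR_cover :: "'i set \<Rightarrow> ('i \<Rightarrow> 'a::euclidean_space set) \<Rightarrow> bool" where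
  "AR_cover I X \<longleftrightarrow> finite I \<and> (\<forall>i\<in>I. closed (X i)) \<and> (\<forall>\<sigma>\<in>nerve I X. AR (\<Inter>i\<in>\<sigma>. X i))"

definition carried ::
  "'i set \<Rightarrow> ('i \<Rightarrow> 'a::topological_space set) \<Rightarrow> ('i \<Rightarrow> 'b::topological_space set) \<Rightarrow> 'a set \<Rightarrow> ('a \<Rightarrow> 'b) \<Rightarrow> bool"
  where "carried I X Z D f \<longleftrightarrow> continuous_on D f \<and> (\<forall>i\<in>I. \<forall>x\<in>D \<inter> X i. f x \<in> Z i)"

lemma nerve_iff: "\<sigma> \<in> nerve I X \<longleftrightarrow> \<sigma> \<subseteq> I \<and> \<sigma> \<noteq> {} \<and> (\<exists>x. \<forall>i\<in>\<sigma>. x \<in> X i)"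
  unfolding nerve_def by blast

lemma finite_nerve: "finite I \<Longrightarrow> finite (nerve I X)"
  by (rule finite_subset[of _ "Pow I"]) (auto simp: nerve_def)

lemma carried_subset: "carried I X Z D f \<Longrightarrow> D' \<subseteq> D \<Longrightarrow> carried I X Z D' f"
  unfolding carried_def using continuous_on_subset by blast

lemma carried_UN_iff:
  "carried I X Z (\<Union>i\<in>I. X i) f \<longleftrightarrow> continuous_on (\<Union>i\<in>I. X i) f \<and> (\<forall>i\<in>I. f ` X i \<subseteq> Z i)"
  unfolding carried_def by fast

lemma carried_extension_Inter:
  fixes X :: "'i \<Rightarrow> 'a::euclidean_space set" and Z :: "'i \<Rightarrow> 'b::euclidean_space set"
  assumes "closed D" "carried I X Z D h" "closed (\<Inter>i\<in>\<sigma>. X i)" "\<sigma> \<subseteq> I" "AR (\<Inter>i\<in>\<sigma>. Z i)"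
    and covered: "\<And>k. k \<in> I - \<sigma> \<Longrightarrow> (\<Inter>i\<in>\<sigma>. X i) \<inter> X k \<subseteq> D"
  shows "\<exists>g. carried I X Z (D \<union> (\<Inter>i\<in>\<sigma>. X i)) g \<and> (\<forall>x\<in>D. g x = h x)"
proof -
  let ?Y = "\<Inter>i\<in>\<sigma>. X i" and ?T = "\<Inter>i\<in>\<sigma>. Z i"
  have h: "continuous_on D h" "\<And>x i. \<lbrakk>x \<in> D; i \<in> I; x \<in> X i\<rbrakk> \<Longrightarrow> h x \<in> Z i"
    using assms(2) by (auto simp: carried_def)
  have "h ` (D \<inter> ?Y) \<subseteq> ?T" using h(2) assms(4) by fast
  then obtain g where g: "continuous_on (D \<union> ?Y) g" "\<And>x. x \<in> D \<Longrightarrow> g x = h x" "g ` ?Y \<subseteq> ?T"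
    using AR_extension_closed_Un[OF assms(1,3) h(1) _ assms(5)] by metis
  have "g x \<in> Z k" if "k \<in> I" "x \<in> D \<union> ?Y" "x \<in> X k" for k x
  proof (cases "x \<in> D")
    case True
    then show ?thesis using g(2) h(2) that by simp
  next
    case False
    then have "k \<in> \<sigma>" using covered[of k] that by blast
    then show ?thesis using g(3) that(2) False by blast
  qed
  then show ?thesis using g(1,2) by (intro exI[of _ g]) (simp add: carried_def)
qed

definition upward_closed_in :: "'i set set \<Rightarrow> 'i set set \<Rightarrow> bool" where
  "upward_closed_in N S \<longleftrightarrow> S \<subseteq> N \<and> (\<forall>\<sigma>\<in>S. \<forall>\<tau>\<in>N. \<sigma> \<subseteq> \<tau> \<longrightarrow> \<tau> \<in> S)"

lemma upward_closed_in_Diff_minimal: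
  assumes "upward_closed_in N S" "\<And>\<tau>. \<lbrakk>\<tau> \<in> S; \<tau> \<subseteq> \<sigma>\<rbrakk> \<Longrightarrow> \<tau> = \<sigma>"
  shows "upward_closed_in N (S - {\<sigma>})"
  using assms unfolding upward_closed_in_def by blast

context
  fixes I :: "'i set" and X :: "'i \<Rightarrow> 'a::euclidean_space set" and Z :: "'i \<Rightarrow> 'b::euclidean_space set"
  assumes X: "finite I" "\<forall>i\<in>I. closed (X i)" and Z: "AR_cover I Z" and nerve: "nerve I X \<subseteq> nerve I Z"
begin

text \<open>The map is extended over the intersections \<open>\<Inter>\<^sub>i\<^sub>\<in>\<^sub>\<sigma> X\<^sub>i\<close> one at a time, larger \<open>\<sigma>\<close> first, so that the
  part of a new intersection in a further member of the cover has already been treated.\<close>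

lemma carried_extension_minimal:
  assumes S: "upward_closed_in (nerve I X) S" "\<sigma> \<in> S" and D: "closed D"
    and f: "carried I X Z (D \<union> (\<Union>\<tau>\<in>S - {\<sigma>}. \<Inter>i\<in>\<tau>. X i)) f"
  shows "\<exists>g. carried I X Z (D \<union> (\<Union>\<tau>\<in>S. \<Inter>i\<in>\<tau>. X i)) g \<and> (\<forall>x\<in>D. g x = f x)"
proof -
  let ?D = "D \<union> (\<Union>\<tau>\<in>S - {\<sigma>}. \<Inter>i\<in>\<tau>. X i)"
  have S_nerve: "S \<subseteq> nerve I X" using S(1) by (simp add: upward_closed_in_def)
  then have \<sigma>: "\<sigma> \<subseteq> I" "\<sigma> \<noteq> {}" using S(2) by (auto simp: nerve_def)
  have closed_Inter: "closed (\<Inter>i\<in>\<tau>. X i)" if "\<tau> \<in> S" for \<tau>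
    using that S_nerve X(2) by (intro closed_INT) (auto simp: nerve_def)
  have "finite S" using S_nerve finite_nerve[OF X(1)] finite_subset by blast
  then have "closed ?D" using D closed_Inter by (intro closed_Un closed_UN) auto
  moreover have "AR (\<Inter>i\<in>\<sigma>. Z i)" using Z nerve S_nerve S(2) by (auto simp: AR_cover_def)
  moreover have "(\<Inter>i\<in>\<sigma>. X i) \<inter> X k \<subseteq> ?D" if k: "k \<in> I - \<sigma>" for k
  proof
    fix x assume "x \<in> (\<Inter>i\<in>\<sigma>. X i) \<inter> X k"
    then have x: "x \<in> (\<Inter>i\<in>insert k \<sigma>. X i)" by simp
    then have "insert k \<sigma> \<in> nerve I X" using k \<sigma> by (auto simp: nerve_def)
    then have "insert k \<sigma> \<in> S - {\<sigma>}" using S k unfolding upward_closed_in_def by blast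
    then show "x \<in> ?D" using x by blast
  qed
  ultimately have "\<exists>g. carried I X Z (?D \<union> (\<Inter>i\<in>\<sigma>. X i)) g \<and> (\<forall>x\<in>?D. g x = f x)"
    by (rule carried_extension_Inter[OF _ f closed_Inter[OF S(2)] \<sigma>(1)])
  moreover have "?D \<union> (\<Inter>i\<in>\<sigma>. X i) = D \<union> (\<Union>\<tau>\<in>S. \<Inter>i\<in>\<tau>. X i)" using S(2) by blast
  ultimately show ?thesis by auto
qed

lemma carried_extension_upward_closed:
  assumes "upward_closed_in (nerve I X) S" and D: "closed D" "carried I X Z D h"
  shows "\<exists>f. carried I X Z (D \<union> (\<Union>\<sigma>\<in>S. \<Inter>i\<in>\<sigma>. X i)) f \<and> (\<forall>x\<in>D. f x = h x)"
proof -
  have "finite S" using assms(1) finite_nerve[OF X(1)] finite_subset by (auto simp: upward_closed_in_def)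
  then show ?thesis using assms(1)
  proof (induction S rule: finite_psubset_induct)
    case (psubset S)
    show ?case
    proof (cases "S = {}")
      case True
      then show ?thesis using D by auto
    next
      case False
      then obtain \<sigma> where \<sigma>: "\<sigma> \<in> S" "\<And>\<tau>. \<lbrakk>\<tau> \<in> S; \<tau> \<subseteq> \<sigma>\<rbrakk> \<Longrightarrow> \<tau> = \<sigma>"
        using finite_has_minimal[OF psubset.hyps] by blast
      obtain f where f: "carried I X Z (D \<union> (\<Union>\<tau>\<in>S - {\<sigma>}. \<Inter>i\<in>\<tau>. X i)) f" "\<forall>x\<in>D. f x = h x"
        using psubset.IH[OF _ upward_closed_in_Diff_minimal[OF psubset.prems \<sigma>(2)]] \<sigma>(1) by blast
      then show ?thesis using carried_extension_minimal[OF psubset.prems \<sigma>(1) D(1) f(1)] by auto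
    qed
  qed
qed

lemma carried_extension:
  assumes "closed D" "carried I X Z D h"
  obtains f where "carried I X Z (\<Union>i\<in>I. X i) f" "\<And>x. x \<in> D \<Longrightarrow> f x = h x"
proof -
  have "upward_closed_in (nerve I X) (nerve I X)" by (simp add: upward_closed_in_def)
  then obtain f where f: "carried I X Z (D \<union> (\<Union>\<sigma>\<in>nerve I X. \<Inter>i\<in>\<sigma>. X i)) f" "\<forall>x\<in>D. f x = h x"
    using carried_extension_upward_closed assms by blast
  have "X i \<subseteq> (\<Union>\<sigma>\<in>nerve I X. \<Inter>i\<in>\<sigma>. X i)" if "i \<in> I" for i
    using that by (cases "X i = {}") (auto simp: nerve_def intro!: exI[of _ "{i}"])
  then have "carried I X Z (\<Union>i\<in>I. X i) f" by (intro carried_subset[OF f(1)]) blast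
  then show ?thesis using that f(2) by blast
qed

end

lemma carried_homotopic:
  fixes X :: "'i \<Rightarrow> 'a::euclidean_space set" and Z :: "'i \<Rightarrow> 'b::euclidean_space set"
  assumes X: "finite I" "\<forall>i\<in>I. closed (X i)" and Z: "AR_cover I Z"
    and nerve: "nerve I X \<subseteq> nerve I Z"
    and f: "carried I X Z (\<Union>i\<in>I. X i) f" and g: "carried I X Z (\<Union>i\<in>I. X i) g"
  shows "homotopic_with_canon (\<lambda>x. True) (\<Union>i\<in>I. X i) (\<Union>i\<in>I. Z i) f g"
proof -
  let ?X = "\<Union>i\<in>I. X i" and ?C = "\<lambda>i. {0..1::real} \<times> X i"
  let ?D = "{0::real} \<times> ?X \<union> {1} \<times> ?X"
  define h where "h = (\<lambda>y::real \<times> 'a. if y \<in> {0} \<times> ?X then f (snd y) else g (snd y))"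
  have closed_X: "closed ?X" using X by (auto intro: closed_UN)
  have cont: "continuous_on ?X f" "continuous_on ?X g" using f g by (auto simp: carried_def)
  have "continuous_on ?D h" unfolding h_def
  proof (rule continuous_on_If)
    show "continuous_on ({0::real} \<times> ?X) (\<lambda>y. f (snd y))" "continuous_on ({1::real} \<times> ?X) (\<lambda>y. g (snd y))"
      by (intro continuous_on_compose2[OF cont(1)] continuous_on_compose2[OF cont(2)]
          continuous_intros; force)+
  qed (use closed_X in \<open>auto intro: closed_Times\<close>)
  then have h: "carried I ?C Z ?D h"
    using f g unfolding carried_UN_iff by (auto simp: carried_def h_def image_subset_iff)
  have "\<sigma> \<in> nerve I X" if \<sigma>: "\<sigma> \<in> nerve I ?C" for \<sigma>
  proof -
    obtain y where "\<forall>i\<in>\<sigma>. y \<in> ?C i" using \<sigma> unfolding nerve_iff by blast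
    then have "\<forall>i\<in>\<sigma>. snd y \<in> X i" by (simp add: mem_Times_iff)
    then show ?thesis using \<sigma> unfolding nerve_iff by blast
  qed
  then have nerve_C: "nerve I ?C \<subseteq> nerve I Z" using nerve by blast
  have "\<forall>i\<in>I. closed (?C i)" "closed ?D" using X closed_X by (auto intro!: closed_Times closed_Un)
  then obtain k where k: "carried I ?C Z (\<Union>i\<in>I. ?C i) k" "\<And>y. y \<in> ?D \<Longrightarrow> k y = h y"
    using carried_extension[OF X(1) _ Z nerve_C _ h] by metis
  have "(\<Union>i\<in>I. ?C i) = {0..1} \<times> ?X" by auto
  then have "continuous_on ({0..1} \<times> ?X) k" "k ` ({0..1} \<times> ?X) \<subseteq> (\<Union>i\<in>I. Z i)"
    using k(1) unfolding carried_UN_iff by (simp, fast)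
  then have "continuous_map (prod_topology (top_of_set {0..1}) (top_of_set ?X)) (top_of_set (\<Union>i\<in>I. Z i)) k"
    by (simp add: image_subset_iff_funcset)
  moreover have "k (0, x) = f x" "k (1, x) = g x" if "x \<in> ?X" for x
    using k(2) that by (auto simp: h_def)
  ultimately show ?thesis by (subst homotopic_with) auto
qed

lemma carried_compose:
  assumes "carried I X Z (\<Union>i\<in>I. X i) f" "carried I Z Y (\<Union>i\<in>I. Z i) g"
  shows "carried I X Y (\<Union>i\<in>I. X i) (g \<circ> f)"
proof -
  have "f ` (\<Union>i\<in>I. X i) \<subseteq> (\<Union>i\<in>I. Z i)" using assms(1) unfolding carried_UN_iff by fast
  then have "continuous_on (\<Union>i\<in>I. X i) (g \<circ> f)"
    using assms unfolding carried_UN_iff by (intro continuous_on_compose) (auto elim: continuous_on_subset)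
  then show ?thesis using assms unfolding carried_UN_iff by (fastforce simp: image_subset_iff)
qed

theorem nerve_eq_imp_homotopy_eqv:
  fixes X :: "'i \<Rightarrow> 'a::euclidean_space set" and Z :: "'i \<Rightarrow> 'b::euclidean_space set"
  assumes X: "AR_cover I X" and Z: "AR_cover I Z" and nerve: "nerve I X = nerve I Z"
  shows "(\<Union>i\<in>I. X i) homotopy_eqv (\<Union>i\<in>I. Z i)"
proof -
  have finite_I: "finite I" and closed_X: "\<forall>i\<in>I. closed (X i)" and closed_Z: "\<forall>i\<in>I. closed (Z i)"
    using X Z by (auto simp: AR_cover_def)
  obtain f where f: "carried I X Z (\<Union>i\<in>I. X i) f"
    using carried_extension[OF finite_I closed_X Z, where D = "{}"] nerve by (auto simp: carried_def)
  obtain g where g: "carried I Z X (\<Union>i\<in>I. Z i) g"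
    using carried_extension[OF finite_I closed_Z X, where D = "{}"] nerve by (auto simp: carried_def)
  have id: "carried I Y Y (\<Union>i\<in>I. Y i) id" for Y :: "'i \<Rightarrow> 'c::euclidean_space set"
    by (auto simp: carried_def)
  have "homotopic_with_canon (\<lambda>x. True) (\<Union>i\<in>I. X i) (\<Union>i\<in>I. X i) (g \<circ> f) id"
    using carried_homotopic[OF finite_I closed_X X order_refl carried_compose[OF f g] id] .
  moreover have "homotopic_with_canon (\<lambda>x. True) (\<Union>i\<in>I. Z i) (\<Union>i\<in>I. Z i) (f \<circ> g) id"
    using carried_homotopic[OF finite_I closed_Z Z order_refl carried_compose[OF g f] id] .
  moreover have "f ` (\<Union>i\<in>I. X i) \<subseteq> (\<Union>i\<in>I. Z i)" "g ` (\<Union>i\<in>I. Z i) \<subseteq> (\<Union>i\<in>I. X i)"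
    using f g unfolding carried_UN_iff by fast+
  ultimately show ?thesis
    using f g unfolding homotopy_equivalent_space_def carried_UN_iff
    by (intro exI[of _ f] exI[of _ g]) (simp add: image_subset_iff_funcset)
qed

section \<open>Covers whose nerve is a graph\<close>

definition graph_AR_cover :: "'i set \<Rightarrow> ('i \<Rightarrow> 'a::euclidean_space set) \<Rightarrow> bool" where
  "graph_AR_cover I X \<longleftrightarrow> finite I \<and> (\<forall>i\<in>I. closed (X i) \<and> AR (X i))
     \<and> (\<forall>i\<in>I. \<forall>j\<in>I. i \<noteq> j \<longrightarrow> X i \<inter> X j \<noteq> {} \<longrightarrow> AR (X i \<inter> X j))
     \<and> (\<forall>i\<in>I. \<forall>j\<in>I. \<forall>k\<in>I. i \<noteq> j \<longrightarrow> j \<noteq> k \<longrightarrow> i \<noteq> k \<longrightarrow> X i \<inter> X j \<inter> X k = {})"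

definition nerve_edges :: "'i set \<Rightarrow> ('i \<Rightarrow> 'a set) \<Rightarrow> 'i set set" where
  "nerve_edges I X = {{i,j} | i j. i \<in> I \<and> j \<in> I \<and> i \<noteq> j \<and> X i \<inter> X j \<noteq> {}}"

lemma graph_AR_cover_nerve:
  assumes "graph_AR_cover I X"
  shows "nerve I X = (\<lambda>i. {i}) ` I \<union> nerve_edges I X"
proof (intro equalityI subsetI)
  fix \<sigma> assume "\<sigma> \<in> nerve I X"
  then obtain x where \<sigma>: "\<sigma> \<subseteq> I" "\<sigma> \<noteq> {}" "\<forall>i\<in>\<sigma>. x \<in> X i" by (auto simp: nerve_iff)
  then obtain i where i: "i \<in> \<sigma>" by blast
  show "\<sigma> \<in> (\<lambda>i. {i}) ` I \<union> nerve_edges I X"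
  proof (cases "\<sigma> = {i}")
    case True
    then show ?thesis using \<sigma>(1) by blast
  next
    case False
    then obtain j where j: "j \<in> \<sigma>" "j \<noteq> i" using i by blast
    have "k = i \<or> k = j" if "k \<in> \<sigma>" for k
    proof (rule ccontr)
      assume "\<not> (k = i \<or> k = j)"
      then have "X i \<inter> X j \<inter> X k = {}"
        using assms i j that \<sigma>(1) unfolding graph_AR_cover_def by blast
      then show False using \<sigma>(3) i j(1) that by blast
    qed
    then have "\<sigma> = {i,j}" using i j(1) by blast
    then show ?thesis using i j \<sigma> unfolding nerve_edges_def by blast
  qed
next
  fix \<sigma> assume "\<sigma> \<in> (\<lambda>i. {i}) ` I \<union> nerve_edges I X"
  moreover have "X i \<noteq> {}" if "i \<in> I" for i
    using assms that by (auto simp: graph_AR_cover_def AR_ANR)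
  ultimately show "\<sigma> \<in> nerve I X" by (auto simp: nerve_def nerve_edges_def)
qed

lemma graph_AR_cover_imp_AR_cover:
  assumes "graph_AR_cover I X"
  shows "AR_cover I X"
proof -
  have "AR (\<Inter>i\<in>\<sigma>. X i)" if "\<sigma> \<in> nerve I X" for \<sigma>
    using that assms unfolding graph_AR_cover_nerve[OF assms] nerve_edges_def graph_AR_cover_def
    by fastforce
  then show ?thesis using assms by (auto simp: AR_cover_def graph_AR_cover_def)
qed

lemma graph_AR_covers_homotopy_eqv:
  fixes X :: "'i \<Rightarrow> 'a::euclidean_space set" and Z :: "'i \<Rightarrow> 'b::euclidean_space set"
  assumes "graph_AR_cover I X" "graph_AR_cover I Z"
    and "\<And>i j. \<lbrakk>i \<in> I; j \<in> I; i \<noteq> j\<rbrakk> \<Longrightarrow> X i \<inter> X j = {} \<longleftrightarrow> Z i \<inter> Z j = {}"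
  shows "(\<Union>i\<in>I. X i) homotopy_eqv (\<Union>i\<in>I. Z i)"
proof (rule nerve_eq_imp_homotopy_eqv)
  have "nerve_edges I X = nerve_edges I Z" using assms(3) unfolding nerve_edges_def by blast
  then show "nerve I X = nerve I Z" using assms(1,2) by (simp add: graph_AR_cover_nerve)
qed (use assms in \<open>auto intro: graph_AR_cover_imp_AR_cover\<close>)

section \<open>Loops attached to a contractible hub\<close>

text \<open>Each loop is cut into two halves \<open>L e\<close> and \<open>R e\<close> because \<open>Y \<inter> (L e \<union> R e)\<close> is disconnected and hence
  not an absolute retract.\<close>

definition loop_AR_cover ::
  "'e set \<Rightarrow> 'a::euclidean_space set \<Rightarrow> ('e \<Rightarrow> 'a set) \<Rightarrow> ('e \<Rightarrow> 'a set) \<Rightarrow> bool" where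
  "loop_AR_cover S Y L R \<longleftrightarrow> finite S \<and> closed Y \<and> AR Y \<and>
     (\<forall>e\<in>S. closed (L e) \<and> closed (R e) \<and> AR (L e) \<and> AR (R e) \<and> AR (Y \<inter> L e) \<and> AR (Y \<inter> R e)
        \<and> AR (L e \<inter> R e) \<and> Y \<inter> L e \<inter> R e = {}) \<and>
     (\<forall>e\<in>S. \<forall>e'\<in>S. e \<noteq> e' \<longrightarrow> (L e \<union> R e) \<inter> (L e' \<union> R e') = {})"

datatype 'e loop_index = Hub | Left_Half 'e | Right_Half 'e

primrec loop_piece :: "'a set \<Rightarrow> ('e \<Rightarrow> 'a set) \<Rightarrow> ('e \<Rightarrow> 'a set) \<Rightarrow> 'e loop_index \<Rightarrow> 'a set" where
  "loop_piece Y L R Hub = Y"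
| "loop_piece Y L R (Left_Half e) = L e"
| "loop_piece Y L R (Right_Half e) = R e"

definition loop_indices :: "'e set \<Rightarrow> 'e loop_index set" where
  "loop_indices S = insert Hub (Left_Half ` S \<union> Right_Half ` S)"

lemma UN_loop_piece: "(\<Union>i\<in>loop_indices S. loop_piece Y L R i) = Y \<union> (\<Union>e\<in>S. L e \<union> R e)"
  by (auto simp: loop_indices_def)

fun loop_adjacent :: "'e loop_index \<Rightarrow> 'e loop_index \<Rightarrow> bool" where
  "loop_adjacent (Left_Half e) (Left_Half e') \<longleftrightarrow> e = e'"
| "loop_adjacent (Left_Half e) (Right_Half e') \<longleftrightarrow> e = e'"
| "loop_adjacent (Right_Half e) (Left_Half e') \<longleftrightarrow> e = e'"
| "loop_adjacent (Right_Half e) (Right_Half e') \<longleftrightarrow> e = e'"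
| "loop_adjacent _ _ \<longleftrightarrow> True"

context
  fixes S :: "'e set" and Y :: "'a::euclidean_space set" and L R :: "'e \<Rightarrow> 'a set"
  assumes cover: "loop_AR_cover S Y L R"
begin

lemma loop_piece_disjoint:
  assumes "i \<in> loop_indices S" "j \<in> loop_indices S" "\<not> loop_adjacent i j"
  shows "loop_piece Y L R i \<inter> loop_piece Y L R j = {}"
proof -
  have "L e \<inter> L e' = {}" "L e \<inter> R e' = {}" "R e \<inter> L e' = {}" "R e \<inter> R e' = {}"
    if "e \<in> S" "e' \<in> S" "e \<noteq> e'" for e e'
    using cover that unfolding loop_AR_cover_def by blast+
  then show ?thesis
    using assms by (cases i; cases j) (simp_all add: loop_indices_def image_iff)
qed

lemma AR_loop_piece_Int:
  assumes "i \<in> loop_indices S" "j \<in> loop_indices S" "loop_adjacent i j"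
  shows "AR (loop_piece Y L R i \<inter> loop_piece Y L R j)"
  using assms cover
  by (cases i; cases j) (auto simp: loop_indices_def loop_AR_cover_def Int_commute)

lemma loop_piece_Int_empty_iff:
  assumes "i \<in> loop_indices S" "j \<in> loop_indices S"
  shows "loop_piece Y L R i \<inter> loop_piece Y L R j = {} \<longleftrightarrow> \<not> loop_adjacent i j"
  using loop_piece_disjoint[OF assms] AR_loop_piece_Int[OF assms] by (auto simp: AR_ANR)

lemma loop_piece_Int3_empty:
  assumes "i \<in> loop_indices S" "j \<in> loop_indices S" "k \<in> loop_indices S" "i \<noteq> j" "j \<noteq> k" "i \<noteq> k"
  shows "loop_piece Y L R i \<inter> loop_piece Y L R j \<inter> loop_piece Y L R k = {}"
proof (cases "loop_adjacent i j \<and> loop_adjacent j k \<and> loop_adjacent i k")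
  case True
  have "Y \<inter> L e \<inter> R e = {}" if "e \<in> S" for e using cover that by (simp add: loop_AR_cover_def)
  then show ?thesis
    using assms True by (cases i; cases j; cases k) (auto simp: loop_indices_def)
next
  case False
  then show ?thesis using loop_piece_disjoint assms by blast
qed

lemma loop_graph_AR_cover: "graph_AR_cover (loop_indices S) (loop_piece Y L R)"
proof -
  have "loop_adjacent i i" for i :: "'e loop_index" by (cases i) auto
  then have "AR (loop_piece Y L R i)" if "i \<in> loop_indices S" for i
    using AR_loop_piece_Int[of i i] that by simp
  moreover have "finite (loop_indices S)" "\<forall>i\<in>loop_indices S. closed (loop_piece Y L R i)"
    using cover by (auto simp: loop_indices_def loop_AR_cover_def)
  ultimately show ?thesis
    unfolding graph_AR_cover_def
    using AR_loop_piece_Int loop_piece_Int_empty_iff loop_piece_Int3_empty by blast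
qed

end

lemma loop_AR_covers_homotopy_eqv:
  fixes Y :: "'a::euclidean_space set" and Y' :: "'b::euclidean_space set"
  assumes "loop_AR_cover S Y L R" "loop_AR_cover S Y' L' R'"
  shows "(Y \<union> (\<Union>e\<in>S. L e \<union> R e)) homotopy_eqv (Y' \<union> (\<Union>e\<in>S. L' e \<union> R' e))"
  unfolding UN_loop_piece[symmetric]
  by (rule graph_AR_covers_homotopy_eqv)
    (use assms in \<open>simp_all add: loop_graph_AR_cover loop_piece_Int_empty_iff\<close>)

lemma loop_AR_cover_reindex:
  assumes "bij_betw g S T" "loop_AR_cover T Y L R"
  shows "loop_AR_cover S Y (L \<circ> g) (R \<circ> g)"
proof -
  have "finite S" "\<And>e. e \<in> S \<Longrightarrow> g e \<in> T" "\<And>e e'. \<lbrakk>e \<in> S; e' \<in> S; e \<noteq> e'\<rbrakk> \<Longrightarrow> g e \<noteq> g e'"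
    using assms bij_betw_finite[OF assms(1)] by (auto simp: bij_betw_def inj_on_def loop_AR_cover_def)
  then show ?thesis using assms(2) by (simp add: loop_AR_cover_def)
qed

section \<open>The bouquet of circles\<close>

definition graph_over_Im :: "(real \<Rightarrow> real) \<Rightarrow> real set \<Rightarrow> complex set" where
  "graph_over_Im f T = {z. Im z \<in> T \<and> Re z = f (Im z)}"

lemma
  assumes "a \<le> b" "continuous_on {a..b} f"
  shows AR_graph_over_Im: "AR (graph_over_Im f {a..b})"
    and closed_graph_over_Im: "closed (graph_over_Im f {a..b})"
proof -
  let ?g = "\<lambda>t. Complex (f t) t"
  have as_image: "graph_over_Im f {a..b} = ?g ` {a..b}"
    by (force simp: graph_over_Im_def complex_eq_iff image_iff)
  have cont: "continuous_on {a..b} ?g"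
    by (intro continuous_intros assms continuous_on_Complex)
  then have "homeomorphism {a..b} (?g ` {a..b}) ?g Im"
    unfolding homeomorphism_def by (auto intro!: continuous_intros simp: image_image)
  then have "(?g ` {a..b}) homeomorphic {a..b}"
    using homeomorphic_def homeomorphic_sym by blast
  moreover have "AR {a..b}" using assms(1) by (intro convex_imp_AR) auto
  ultimately show "AR (graph_over_Im f {a..b})" unfolding as_image using AR_homeomorphic_AR by blast
  show "closed (graph_over_Im f {a..b})"
    unfolding as_image using compact_continuous_image[OF cont] by (simp add: compact_imp_closed)
qed

definition half_chord :: "real \<Rightarrow> real \<Rightarrow> real" where "half_chord r t = sqrt (r\<^sup>2 - t\<^sup>2)"

lemma continuous_on_half_chord [continuous_intros]: "continuous_on T (half_chord r)"
  unfolding half_chord_def by (intro continuous_intros)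

definition left_arc :: "nat \<Rightarrow> complex set" where
  "left_arc e = graph_over_Im (\<lambda>t. e - half_chord e t) {- real e..real e}"
definition upper_arc :: "nat \<Rightarrow> complex set" where
  "upper_arc e = graph_over_Im (\<lambda>t. e + half_chord e t) {0..real e}"
definition lower_arc :: "nat \<Rightarrow> complex set" where
  "lower_arc e = graph_over_Im (\<lambda>t. e + half_chord e t) {- real e..0}"

lemmas arc_defs = left_arc_def upper_arc_def lower_arc_def graph_over_Im_def

lemma AR_arcs: "AR (left_arc e)" "AR (upper_arc e)" "AR (lower_arc e)"
  unfolding left_arc_def upper_arc_def lower_arc_def
  by (intro AR_graph_over_Im continuous_intros; simp)+

lemma closed_arcs: "closed (left_arc e)" "closed (upper_arc e)" "closed (lower_arc e)"
  unfolding left_arc_def upper_arc_def lower_arc_def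
  by (intro closed_graph_over_Im continuous_intros; simp)+

lemma in_sphere_iff: "z \<in> sphere (of_nat e) (of_nat e) \<longleftrightarrow> (Re z - e)\<^sup>2 + (Im z)\<^sup>2 = (real e)\<^sup>2"
proof -
  have "z \<in> sphere (of_nat e) (of_nat e) \<longleftrightarrow> sqrt ((Re z - e)\<^sup>2 + (Im z)\<^sup>2) = sqrt ((real e)\<^sup>2)"
    by (simp add: dist_norm cmod_def power2_commute)
  then show ?thesis by (simp only: real_sqrt_eq_iff)
qed

lemma in_sphere_iff_half_chord:
  "z \<in> sphere (of_nat e) (of_nat e) \<longleftrightarrow> \<bar>Im z\<bar> \<le> e \<and> \<bar>Re z - e\<bar> = half_chord e (Im z)"
proof -
  have "z \<in> sphere (of_nat e) (of_nat e) \<longleftrightarrow> (Im z)\<^sup>2 \<le> (real e)\<^sup>2 \<and> sqrt ((Re z - e)\<^sup>2) = half_chord e (Im z)"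
    unfolding in_sphere_iff half_chord_def real_sqrt_eq_iff using zero_le_power2[of "Re z - e"] by linarith
  then show ?thesis by (simp flip: abs_le_square_iff)
qed

lemma half_chord_nonneg: "\<bar>t\<bar> \<le> r \<Longrightarrow> 0 \<le> half_chord r t"
  using abs_le_square_iff[of t r] by (simp add: half_chord_def)

lemma half_chord_eq_0_iff: "0 \<le> r \<Longrightarrow> half_chord r t = 0 \<longleftrightarrow> \<bar>t\<bar> = r"
  by (auto simp: half_chord_def power2_eq_iff abs_if)

lemma sphere_eq_arcs: "sphere (of_nat e) (of_nat e) = left_arc e \<union> upper_arc e \<union> lower_arc e"
proof (intro set_eqI iffI)
  fix z :: complex assume "z \<in> sphere (of_nat e) (of_nat e)"
  then show "z \<in> left_arc e \<union> upper_arc e \<union> lower_arc e"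
    unfolding in_sphere_iff_half_chord by (auto simp: arc_defs abs_if split: if_splits)
next
  fix z assume "z \<in> left_arc e \<union> upper_arc e \<union> lower_arc e"
  then show "z \<in> sphere (of_nat e) (of_nat e)"
    unfolding in_sphere_iff_half_chord
    using half_chord_nonneg[of "Im z" e] by (auto simp: arc_defs abs_if)
qed

lemma distinct_circles_meet_at_0:
  assumes "z \<in> sphere (of_nat e) (of_nat e)" "z \<in> sphere (of_nat e') (of_nat e')" "e \<noteq> e'"
  shows "z = (0::complex)"
proof -
  have circle: "(Re z)\<^sup>2 + (Im z)\<^sup>2 = 2 * k * Re z" if "z \<in> sphere (of_nat k) (of_nat k)" for k
    using that unfolding in_sphere_iff by (simp add: power2_eq_square algebra_simps)
  have "(real e - real e') * Re z = 0"
    using circle[OF assms(1)] circle[OF assms(2)] by (simp add: algebra_simps)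
  then have "Re z = 0" using assms(3) by simp
  then show ?thesis using circle[OF assms(1)] by (simp add: complex_eq_iff)
qed

lemma upper_lower_arc_on_unique_circle:
  assumes "z \<in> upper_arc e \<union> lower_arc e" "z \<in> sphere (of_nat e') (of_nat e')" "0 < e"
  shows "e = e'"
proof (rule ccontr)
  assume "e \<noteq> e'"
  then have "z = 0" using assms distinct_circles_meet_at_0[of z e e'] by (auto simp: sphere_eq_arcs)
  moreover have "e \<le> Re z" using half_chord_nonneg[of "Im z" e] assms(1) by (auto simp: arc_defs)
  ultimately show False using assms(3) by simp
qed

lemma arc_Ints:
  assumes "0 < e"
  shows "left_arc e \<inter> upper_arc e = {Complex e e}"
    and "left_arc e \<inter> lower_arc e = {Complex e (- real e)}"
    and "upper_arc e \<inter> lower_arc e = {Complex (2 * e) 0}"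
  using half_chord_eq_0_iff[of e] assms
  by (auto simp: arc_defs complex_eq_iff half_chord_def abs_if split: if_splits)

lemma bouquet_loop_AR_cover:
  assumes "1 \<le> N"
  shows "loop_AR_cover {1..N} (\<Union>e\<in>{1..N}. left_arc e) upper_arc lower_arc"
proof -
  let ?Y = "\<Union>e\<in>{1..N}. left_arc e"
  have zero: "0 \<in> left_arc e" for e by (simp add: arc_defs half_chord_def)
  have "AR ({0} \<union> ?Y)"
  proof (rule AR_Un_UN_star)
    show "AR ({0} \<inter> left_arc e)" for e using zero[of e] by (simp add: AR_singleton)
    show "left_arc e \<inter> left_arc e' \<subseteq> {0}" if "e \<noteq> e'" for e e'
      using distinct_circles_meet_at_0[OF _ _ that] unfolding sphere_eq_arcs by blast
  qed (auto simp: AR_singleton AR_arcs closed_arcs)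
  moreover have "{0} \<union> ?Y = ?Y" using zero assms by auto
  ultimately have Y: "AR ?Y" by simp
  have Ints: "?Y \<inter> upper_arc e = {Complex e e}" "?Y \<inter> lower_arc e = {Complex e (- real e)}"
    "upper_arc e \<inter> lower_arc e = {Complex (2 * e) 0}" if e: "e \<in> {1..N}" for e
  proof -
    have "?Y \<inter> upper_arc e = left_arc e \<inter> upper_arc e" "?Y \<inter> lower_arc e = left_arc e \<inter> lower_arc e"
      using upper_lower_arc_on_unique_circle[of _ e] e unfolding sphere_eq_arcs by fastforce+
    then show "?Y \<inter> upper_arc e = {Complex e e}" "?Y \<inter> lower_arc e = {Complex e (- real e)}"
      "upper_arc e \<inter> lower_arc e = {Complex (2 * e) 0}" using arc_Ints[of e] e by simp_all
  qed
  have "(upper_arc e \<union> lower_arc e) \<inter> (upper_arc e' \<union> lower_arc e') = {}"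
    if "e \<in> {1..N}" "e \<noteq> e'" for e e'
    using upper_lower_arc_on_unique_circle[of _ e e'] that unfolding sphere_eq_arcs by auto
  moreover have "?Y \<inter> upper_arc e \<inter> lower_arc e = {}" if "e \<in> {1..N}" for e
    unfolding Ints(1)[OF that] using that by (auto simp: arc_defs)
  moreover have "AR (?Y \<inter> upper_arc e)" "AR (?Y \<inter> lower_arc e)" "AR (upper_arc e \<inter> lower_arc e)"
    if "e \<in> {1..N}" for e
    unfolding Ints[OF that] by (rule AR_singleton)+
  ultimately show ?thesis
    unfolding loop_AR_cover_def using Y by (simp add: AR_arcs closed_arcs closed_UN)
qed

theorem loop_AR_cover_homotopy_eqv_bouquet:
  assumes "loop_AR_cover S Y L R" "S \<noteq> {}"
  shows "(Y \<union> (\<Union>e\<in>S. L e \<union> R e)) homotopy_eqv bouquet (card S)"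
proof -
  have fin: "finite S" using assms(1) by (simp add: loop_AR_cover_def)
  then have "1 \<le> card S" using assms(2) by (simp add: Suc_leI card_gt_0_iff)
  obtain g where g: "bij_betw g S {1..card S}"
    using ex_bij_betw_finite_nat finite_same_card_bij[of S "{1..card S}"] fin by auto
  let ?Y = "\<Union>e\<in>{1..card S}. left_arc e"
  have "bouquet (card S) = ?Y \<union> (\<Union>e\<in>{1..card S}. upper_arc e \<union> lower_arc e)"
    unfolding bouquet_def sphere_eq_arcs by blast
  also have "\<dots> = ?Y \<union> (\<Union>e\<in>S. (upper_arc \<circ> g) e \<union> (lower_arc \<circ> g) e)"
    using bij_betw_imp_surj_on[OF g, symmetric] by (simp add: image_comp)
  finally show ?thesis
    using loop_AR_covers_homotopy_eqv[OF assms(1) loop_AR_cover_reindex[OF g bouquet_loop_AR_cover]]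
      \<open>1 \<le> card S\<close> by simp
qed

section \<open>Covers with connected nerve\<close>

text \<open>The telescope \<open>\<Union>\<^sub>i X\<^sub>i \<times> {i} \<union> \<Union>\<^sub>i\<^sub><\<^sub>j (X\<^sub>i \<inter> X\<^sub>j) \<times> [i, j]\<close> has a cover with the same nerve as
  \<open>X\<close>, and the part of it over a spanning tree of the nerve is an absolute retract to which the remaining
  edges are attached as loops.\<close>

definition slice :: "(nat \<Rightarrow> 'a::euclidean_space set) \<Rightarrow> nat \<Rightarrow> ('a \<times> real) set" where
  "slice X i = X i \<times> {real i}"

definition arm :: "(nat \<Rightarrow> 'a::euclidean_space set) \<Rightarrow> nat \<Rightarrow> nat \<Rightarrow> ('a \<times> real) set" where
  "arm X i j = (X i \<inter> X j) \<times> closed_segment (real i) (midpoint (real i) (real j))"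

definition bridge :: "(nat \<Rightarrow> 'a::euclidean_space set) \<Rightarrow> nat \<Rightarrow> nat \<Rightarrow> ('a \<times> real) set" where
  "bridge X i j = arm X i j \<union> arm X j i"

lemma mem_slice_iff: "y \<in> slice X i \<longleftrightarrow> fst y \<in> X i \<and> snd y = i"
  by (cases y) (auto simp: slice_def)

lemma mem_arm_iff:
  "y \<in> arm X i j \<longleftrightarrow> fst y \<in> X i \<and> fst y \<in> X j \<and>
     (if i \<le> j then real i \<le> snd y \<and> 2 * snd y \<le> i + j else snd y \<le> i \<and> i + j \<le> 2 * snd y)"
  by (cases y) (auto simp: arm_def midpoint_def closed_segment_eq_real_ivl)

lemma bridge_eq: "i \<le> j \<Longrightarrow> bridge X i j = (X i \<inter> X j) \<times> {real i..real j}"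
  using of_nat_mono[of i j, where 'a = real] by (auto simp: bridge_def mem_arm_iff split: if_splits)

lemma slice_Int_arm: "i \<noteq> j \<Longrightarrow> slice X i \<inter> arm X i j = (X i \<inter> X j) \<times> {real i}"
  by (auto simp: mem_slice_iff mem_arm_iff)

lemma arm_Int_arm: "i \<noteq> j \<Longrightarrow> arm X i j \<inter> arm X j i = (X i \<inter> X j) \<times> {midpoint (real i) (real j)}"
  by (auto simp: mem_arm_iff midpoint_def field_simps split: if_splits)

definition edge_pairs :: "nat \<Rightarrow> (nat \<Rightarrow> 'a set) \<Rightarrow> (nat \<times> nat) set" where
  "edge_pairs m X = {(i,j). i < j \<and> j < m \<and> X i \<inter> X j \<noteq> {}}"

definition telescope :: "nat \<Rightarrow> (nat \<Rightarrow> 'a::euclidean_space set) \<Rightarrow> ('a \<times> real) set" where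
  "telescope m X = (\<Union>i<m. slice X i) \<union> (\<Union>(i,j)\<in>edge_pairs m X. bridge X i j)"

locale telescope_cover =
  fixes m :: nat and X :: "nat \<Rightarrow> 'a::euclidean_space set"
  assumes cover: "graph_AR_cover {..<m} X"
begin

lemma third_index:
  assumes "x \<in> X i" "x \<in> X j" "x \<in> X k" "i < m" "j < m" "k < m" "i \<noteq> j"
  shows "k = i \<or> k = j"
  using cover assms unfolding graph_AR_cover_def by blast

lemma AR_member: "i < m \<Longrightarrow> AR (X i)" and closed_member: "i < m \<Longrightarrow> closed (X i)"
  using cover by (auto simp: graph_AR_cover_def)

lemma AR_Int_Times:
  assumes "i < m" "j < m" "i \<noteq> j" "X i \<inter> X j \<noteq> {}" "convex T" "closed T" "T \<noteq> {}"
  shows "AR ((X i \<inter> X j) \<times> (T :: real set))"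
proof (rule AR_Times)
  show "AR (X i \<inter> X j)" using cover assms(1-4) by (auto simp: graph_AR_cover_def)
  show "AR T" using assms(5-7) by (intro convex_imp_AR)
qed

lemma AR_slice: "i < m \<Longrightarrow> AR (slice X i)" and closed_slice: "i < m \<Longrightarrow> closed (slice X i)"
  unfolding slice_def using AR_member[of i] closed_member[of i]
  by (auto intro!: AR_Times AR_singleton closed_Times)

lemma AR_arm: "\<lbrakk>i < m; j < m; i \<noteq> j; X i \<inter> X j \<noteq> {}\<rbrakk> \<Longrightarrow> AR (arm X i j)"
  unfolding arm_def by (rule AR_Int_Times) auto

lemma closed_arm: "\<lbrakk>i < m; j < m\<rbrakk> \<Longrightarrow> closed (arm X i j)"
  unfolding arm_def using closed_member by (intro closed_Times closed_Int) auto

definition neighbours :: "nat \<Rightarrow> nat set" where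
  "neighbours i = {j. j < m \<and> j \<noteq> i \<and> X i \<inter> X j \<noteq> {}}"

definition spider :: "nat \<Rightarrow> ('a \<times> real) set" where
  "spider i = slice X i \<union> (\<Union>j\<in>neighbours i. arm X i j)"

lemma fst_mem_spider: "y \<in> spider i \<Longrightarrow> fst y \<in> X i"
  by (auto simp: spider_def mem_slice_iff mem_arm_iff)

lemma AR_spider:
  assumes "i < m"
  shows "AR (spider i)"
  unfolding spider_def
proof (rule AR_Un_UN_star)
  fix j assume j: "j \<in> neighbours i"
  then show "AR (slice X i \<inter> arm X i j)"
    using assms AR_Int_Times[of i j "{real i}"] by (simp add: neighbours_def slice_Int_arm)
  show "closed (arm X i j)" "AR (arm X i j)"
    using assms j by (auto simp: neighbours_def intro: closed_arm AR_arm)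
  show "arm X i j \<inter> arm X i k \<subseteq> slice X i" if "k \<in> neighbours i" "j \<noteq> k" for k
    using third_index[of _ i j k] j that assms by (auto simp: neighbours_def mem_arm_iff)
qed (use assms in \<open>auto simp: neighbours_def closed_slice AR_slice\<close>)

lemma closed_spider:
  assumes "i < m"
  shows "closed (spider i)"
  unfolding spider_def
  by (intro closed_Un closed_slice closed_UN ballI closed_arm) (use assms in \<open>auto simp: neighbours_def\<close>)

lemma spider_over_Int:
  assumes "y \<in> spider i" "fst y \<in> X j" "i < m" "j < m" "i \<noteq> j"
  shows "y \<in> slice X i \<union> arm X i j"
proof (cases "y \<in> slice X i")
  case False
  then obtain l where l: "l \<in> neighbours i" "y \<in> arm X i l" using assms(1) by (auto simp: spider_def)
  then have "l = j"
    using third_index[of "fst y" i j l] assms by (auto simp: neighbours_def mem_arm_iff)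
  then show ?thesis using l(2) by simp
qed simp

lemma spider_Int:
  assumes "i < m" "j < m" "i \<noteq> j"
  shows "spider i \<inter> spider j = (X i \<inter> X j) \<times> {midpoint (real i) (real j)}"
proof (intro equalityI subsetI)
  fix y assume y: "y \<in> spider i \<inter> spider j"
  then have fst_y: "fst y \<in> X i" "fst y \<in> X j" using fst_mem_spider by auto
  have "y \<in> slice X i \<union> arm X i j" "y \<in> slice X j \<union> arm X j i"
    using y spider_over_Int[OF _ fst_y(2)] spider_over_Int[OF _ fst_y(1)] assms by auto
  then have "y \<in> arm X i j \<inter> arm X j i"
    using assms(3) fst_y by (auto simp: mem_slice_iff mem_arm_iff split: if_splits)
  then show "y \<in> (X i \<inter> X j) \<times> {midpoint (real i) (real j)}" unfolding arm_Int_arm[OF assms(3)] .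
next
  fix y assume "y \<in> (X i \<inter> X j) \<times> {midpoint (real i) (real j)}"
  then have "y \<in> arm X i j \<inter> arm X j i" "X i \<inter> X j \<noteq> {}" using arm_Int_arm[OF assms(3), of X] by auto
  then show "y \<in> spider i \<inter> spider j" using assms by (auto simp: spider_def neighbours_def)
qed

lemma spider_graph_AR_cover: "graph_AR_cover {..<m} spider"
proof -
  have "spider i \<inter> spider j \<inter> spider k = {}"
    if "i < m" "j < m" "k < m" "i \<noteq> j" "j \<noteq> k" "i \<noteq> k" for i j k
    using fst_mem_spider third_index[of _ i j k] that by fastforce
  moreover have "AR (spider i \<inter> spider j)"
    if "i < m" "j < m" "i \<noteq> j" "spider i \<inter> spider j \<noteq> {}" for i j
    using that AR_Int_Times[of i j "{midpoint (real i) (real j)}"] by (auto simp: spider_Int)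
  ultimately show ?thesis
    unfolding graph_AR_cover_def using AR_spider closed_spider by auto
qed

lemma UN_spider: "(\<Union>i<m. spider i) = telescope m X"
proof -
  have "(\<Union>i<m. \<Union>j\<in>neighbours i. arm X i j) = (\<Union>(i,j)\<in>edge_pairs m X. bridge X i j)"
  proof (intro equalityI subsetI)
    fix y assume "y \<in> (\<Union>i<m. \<Union>j\<in>neighbours i. arm X i j)"
    then obtain i j where "i < m" "j < m" "j \<noteq> i" "X i \<inter> X j \<noteq> {}" "y \<in> arm X i j"
      by (auto simp: neighbours_def)
    then have "(min i j, max i j) \<in> edge_pairs m X" "y \<in> bridge X (min i j) (max i j)"
      by (auto simp: edge_pairs_def bridge_def min_def max_def)
    then show "y \<in> (\<Union>(i,j)\<in>edge_pairs m X. bridge X i j)" by blast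
  next
    fix y assume "y \<in> (\<Union>(i,j)\<in>edge_pairs m X. bridge X i j)"
    then obtain i j where ij: "(i,j) \<in> edge_pairs m X" "y \<in> arm X i j \<union> arm X j i"
      unfolding bridge_def by blast
    then have "i < m" "j < m" "j \<in> neighbours i" "i \<in> neighbours j"
      by (auto simp: edge_pairs_def neighbours_def)
    then show "y \<in> (\<Union>i<m. \<Union>j\<in>neighbours i. arm X i j)" using ij(2) by blast
  qed
  then show ?thesis unfolding spider_def telescope_def UN_Un_distrib by simp
qed

lemma homotopy_eqv_telescope: "(\<Union>i<m. X i) homotopy_eqv telescope m X"
  unfolding UN_spider[symmetric]
proof (rule graph_AR_covers_homotopy_eqv[OF cover spider_graph_AR_cover])
  show "X i \<inter> X j = {} \<longleftrightarrow> spider i \<inter> spider j = {}" if "i \<in> {..<m}" "j \<in> {..<m}" "i \<noteq> j" for i j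
    using that by (simp add: spider_Int)
qed

lemma mem_bridge_edge_unique:
  assumes "fst y \<in> X i" "fst y \<in> X j" "y \<in> bridge X k l" "(i,j) \<in> edge_pairs m X" "(k,l) \<in> edge_pairs m X"
  shows "(k,l) = (i,j)"
  using assms third_index[of "fst y" i j k] third_index[of "fst y" i j l]
  by (auto simp: edge_pairs_def bridge_def mem_arm_iff)

end

locale rooted_telescope_cover = telescope_cover +
  fixes parent :: "nat \<Rightarrow> nat"
  assumes nonempty: "0 < m"
    and parent: "\<lbrakk>0 < k; k < m\<rbrakk> \<Longrightarrow> parent k < k \<and> X (parent k) \<inter> X k \<noteq> {}"
begin

definition hub :: "nat \<Rightarrow> ('a \<times> real) set" where
  "hub k = (\<Union>i\<le>k. slice X i) \<union> (\<Union>i\<in>{1..k}. bridge X (parent i) i)"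

definition tree_edges :: "(nat \<times> nat) set" where "tree_edges = (\<lambda>k. (parent k, k)) ` {1..<m}"

lemma tree_edges_subset: "tree_edges \<subseteq> edge_pairs m X"
  using parent by (auto simp: tree_edges_def edge_pairs_def)

lemma finite_tree_edges: "finite tree_edges" by (simp add: tree_edges_def)

lemma card_tree_edges: "card tree_edges = m - 1"
  unfolding tree_edges_def by (subst card_image) (auto simp: inj_on_def)

lemma hub_last: "hub (m - 1) = (\<Union>i<m. slice X i) \<union> (\<Union>(i,j)\<in>tree_edges. bridge X i j)"
proof -
  have "{..m - 1} = {..<m}" "{1..m - 1} = {1..<m}" using nonempty by auto
  then show ?thesis by (simp add: hub_def tree_edges_def)
qed

lemma closed_hub:
  assumes "k < m"
  shows "closed (hub k)"
proof -
  have "parent i < m" if "i \<in> {1..k}" for i using parent[of i] that assms by simp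
  then show ?thesis
    unfolding hub_def bridge_def using assms
    by (intro closed_Un closed_UN ballI closed_slice closed_arm) auto
qed

lemma hub_Int_next:
  assumes "Suc k < m"
  defines "p \<equiv> parent (Suc k)"
  shows "hub k \<inter> (slice X (Suc k) \<union> bridge X p (Suc k)) = (X p \<inter> X (Suc k)) \<times> {real p}"
proof (intro equalityI subsetI)
  have p: "p < Suc k" using parent[of "Suc k"] assms by simp
  fix y assume y: "y \<in> hub k \<inter> (slice X (Suc k) \<union> bridge X p (Suc k))"
  then have fst_y: "fst y \<in> X (Suc k)" by (auto simp: mem_slice_iff bridge_def mem_arm_iff)
  from y consider (slice) i where "i \<le> k" "y \<in> slice X i"
    | (bridge) i where "i \<in> {1..k}" "y \<in> bridge X (parent i) i"
    by (auto simp: hub_def)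
  then show "y \<in> (X p \<inter> X (Suc k)) \<times> {real p}"
  proof cases
    case slice
    then have "y \<in> bridge X p (Suc k)" using y by (auto simp: mem_slice_iff)
    then have "fst y \<in> X p" by (auto simp: bridge_def mem_arm_iff)
    then have "i = p" using third_index[of "fst y" p "Suc k" i] slice fst_y p assms(1)
      by (auto simp: mem_slice_iff)
    then show ?thesis using slice(2) fst_y by (cases y) (simp add: mem_slice_iff)
  next
    case bridge
    then have i: "parent i < i" "i < m" using parent[of i] assms(1) by auto
    have "fst y \<in> X (parent i)" "fst y \<in> X i" using bridge(2) by (auto simp: bridge_def mem_arm_iff)
    then have "Suc k = parent i \<or> Suc k = i"
      using third_index[of "fst y" "parent i" i "Suc k"] fst_y i assms(1) by simp
    then show ?thesis using bridge(1) i(1) by simp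
  qed
next
  fix y assume "y \<in> (X p \<inter> X (Suc k)) \<times> {real p}"
  moreover have "p \<le> k" using parent[of "Suc k"] assms by simp
  ultimately show "y \<in> hub k \<inter> (slice X (Suc k) \<union> bridge X p (Suc k))"
    by (auto simp: hub_def bridge_eq mem_slice_iff)
qed

lemma AR_hub: "k < m \<Longrightarrow> AR (hub k)"
proof (induction k)
  case 0
  then show ?case by (simp add: hub_def AR_slice)
next
  case (Suc k)
  let ?p = "parent (Suc k)"
  have p: "?p < Suc k" "X ?p \<inter> X (Suc k) \<noteq> {}" using parent[of "Suc k"] Suc.prems by auto
  then have AR_Int: "AR ((X ?p \<inter> X (Suc k)) \<times> T)" if "convex T" "closed T" "T \<noteq> {}" for T :: "real set"
    using that Suc.prems by (intro AR_Int_Times) auto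
  have closed: "closed (slice X (Suc k))" "closed (bridge X ?p (Suc k))"
    using p Suc.prems by (auto simp: bridge_def closed_slice closed_arm)
  have "slice X (Suc k) \<inter> bridge X ?p (Suc k) = (X ?p \<inter> X (Suc k)) \<times> {real (Suc k)}"
    using p(1) by (auto simp: bridge_eq mem_slice_iff)
  then have "AR (slice X (Suc k) \<union> bridge X ?p (Suc k))"
    using p closed Suc.prems AR_Int[of "{real (Suc k)}"] AR_Int[of "{real ?p..real (Suc k)}"]
    by (intro AR_closed_Un AR_slice) (auto simp: bridge_eq)
  then have "AR (hub k \<union> (slice X (Suc k) \<union> bridge X ?p (Suc k)))"
    using closed Suc AR_Int[of "{real ?p}"]
    by (intro AR_closed_Un[of "hub k"] closed_hub closed_Un) (simp_all add: hub_Int_next)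
  moreover have "hub (Suc k) = hub k \<union> (slice X (Suc k) \<union> bridge X ?p (Suc k))"
    by (auto simp: hub_def atMost_Suc atLeastAtMostSuc_conv)
  ultimately show ?case by simp
qed

lemma hub_Int_arm:
  assumes ij: "(i,j) \<in> edge_pairs m X - tree_edges \<or> (j,i) \<in> edge_pairs m X - tree_edges"
  shows "hub (m - 1) \<inter> arm X i j = (X i \<inter> X j) \<times> {real i}"
proof (intro equalityI subsetI)
  have bounds: "i < m" "j < m" "i \<noteq> j" using ij by (auto simp: edge_pairs_def)
  fix y assume y: "y \<in> hub (m - 1) \<inter> arm X i j"
  then have fst_y: "fst y \<in> X i" "fst y \<in> X j" by (auto simp: mem_arm_iff)
  have "y \<notin> bridge X k l" if "(k,l) \<in> tree_edges" for k l
    using mem_bridge_edge_unique[of y i j k l] mem_bridge_edge_unique[of y j i k l]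
      ij fst_y that tree_edges_subset
    by auto
  then obtain k where "k < m" "y \<in> slice X k" using y unfolding hub_last by blast
  moreover have "k = i \<or> k = j"
    using third_index[of "fst y" i j k] fst_y bounds calculation by (simp add: mem_slice_iff)
  ultimately show "y \<in> (X i \<inter> X j) \<times> {real i}"
    using y bounds(3) by (cases y) (auto simp: mem_slice_iff mem_arm_iff split: if_splits)
next
  fix y assume y: "y \<in> (X i \<inter> X j) \<times> {real i}"
  then have "y \<in> slice X i" "i < m" using ij by (auto simp: mem_slice_iff edge_pairs_def)
  then show "y \<in> hub (m - 1) \<inter> arm X i j" using y unfolding hub_last by (auto simp: mem_arm_iff)
qed

lemma telescope_loop_AR_cover:
  "loop_AR_cover (edge_pairs m X - tree_edges) (hub (m - 1))
     (\<lambda>e. arm X (fst e) (snd e)) (\<lambda>e. arm X (snd e) (fst e))"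
proof -
  let ?S = "edge_pairs m X - tree_edges"
  let ?L = "\<lambda>e. arm X (fst e) (snd e)" and ?R = "\<lambda>e. arm X (snd e) (fst e)"
  let ?J = "\<lambda>e. X (fst e) \<inter> X (snd e)"
  have "finite ?S"
    by (rule finite_subset[of _ "{..<m} \<times> {..<m}"]) (auto simp: edge_pairs_def)
  have edge: "fst e < m" "snd e < m" "fst e \<noteq> snd e" "?J e \<noteq> {}" if "e \<in> ?S" for e
    using that by (auto simp: edge_pairs_def)
  have Ints: "hub (m - 1) \<inter> ?L e = ?J e \<times> {real (fst e)}"
    "hub (m - 1) \<inter> ?R e = ?J e \<times> {real (snd e)}"
    "?L e \<inter> ?R e = ?J e \<times> {midpoint (real (fst e)) (real (snd e))}" if "e \<in> ?S" for e
    using that hub_Int_arm[of "fst e" "snd e"] hub_Int_arm[of "snd e" "fst e"]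
      arm_Int_arm[OF edge(3)[OF that], of X] by (auto simp: Int_commute)
  have "AR (?L e)" "AR (?R e)" "closed (?L e)" "closed (?R e)" if "e \<in> ?S" for e
    using edge[OF that] by (auto intro!: AR_arm closed_arm simp: Int_commute)
  moreover have "AR (hub (m - 1) \<inter> ?L e)" "AR (hub (m - 1) \<inter> ?R e)" "AR (?L e \<inter> ?R e)" if "e \<in> ?S" for e
    unfolding Ints[OF that] using edge[OF that] by (intro AR_Int_Times; simp)+
  moreover have "hub (m - 1) \<inter> ?L e \<inter> ?R e = {}" if "e \<in> ?S" for e
    unfolding Ints(1)[OF that] using edge(3)[OF that] by (auto simp: mem_arm_iff split: if_splits)
  moreover have "(?L e \<union> ?R e) \<inter> (?L e' \<union> ?R e') = {}" if "e \<in> ?S" "e' \<in> ?S" "e \<noteq> e'" for e e'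
  proof -
    have False if y: "y \<in> ?L e \<union> ?R e" "y \<in> ?L e' \<union> ?R e'" for y
    proof -
      have "fst y \<in> ?J e" using y(1) by (auto simp: mem_arm_iff)
      then show False
        using mem_bridge_edge_unique[of y "fst e" "snd e" "fst e'" "snd e'"] y(2) \<open>e \<in> ?S\<close> \<open>e' \<in> ?S\<close> \<open>e \<noteq> e'\<close>
        by (simp add: bridge_def)
    qed
    then show ?thesis by blast
  qed
  ultimately show ?thesis
    unfolding loop_AR_cover_def using \<open>finite ?S\<close> closed_hub AR_hub nonempty by simp
qed

theorem homotopy_eqv_bouquet:
  assumes "m \<le> card (edge_pairs m X)"
  shows "(\<Union>i<m. X i) homotopy_eqv bouquet (card (edge_pairs m X) + 1 - m)"
proof -
  let ?S = "edge_pairs m X - tree_edges"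
  have card_S: "card ?S = card (edge_pairs m X) + 1 - m"
    using card_Diff_subset[OF finite_tree_edges tree_edges_subset] nonempty by (simp add: card_tree_edges)
  then have "?S \<noteq> {}" using assms nonempty by (intro notI) simp
  have "telescope m X = hub (m - 1) \<union> (\<Union>(i,j)\<in>?S. bridge X i j)"
    using tree_edges_subset unfolding telescope_def hub_last by blast
  also have "(\<Union>(i,j)\<in>?S. bridge X i j) = (\<Union>e\<in>?S. arm X (fst e) (snd e) \<union> arm X (snd e) (fst e))"
    by (simp add: bridge_def case_prod_beta)
  finally have "telescope m X homotopy_eqv bouquet (card ?S)"
    using loop_AR_cover_homotopy_eqv_bouquet[OF telescope_loop_AR_cover \<open>?S \<noteq> {}\<close>] by simp
  then show ?thesis unfolding card_S using homotopy_eqv_telescope homotopy_eqv_trans by blast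
qed

end

lemma rtranclp_leaves_set:
  assumes "R\<^sup>*\<^sup>* x y" "x \<in> A" "y \<notin> A"
  obtains u v where "u \<in> A" "v \<notin> A" "R u v"
proof -
  have "\<exists>u v. u \<in> A \<and> v \<notin> A \<and> R u v" using assms
    by (induction rule: rtranclp_induct) blast+
  then show ?thesis using that by blast
qed

lemma connected_enumeration:
  assumes "finite I" "r \<in> I"
    and connected: "\<And>i. i \<in> I \<Longrightarrow> (\<lambda>i j. i \<in> I \<and> j \<in> I \<and> R i j)\<^sup>*\<^sup>* r i"
  obtains xs where "distinct xs" "set xs = I" "\<And>k. \<lbrakk>0 < k; k < length xs\<rbrakk> \<Longrightarrow> \<exists>j<k. R (xs ! j) (xs ! k)"
proof -
  define grown where
    "grown xs \<longleftrightarrow> distinct xs \<and> r \<in> set xs \<and> set xs \<subseteq> I \<and> (\<forall>k<length xs. 0 < k \<longrightarrow> (\<exists>j<k. R (xs ! j) (xs ! k)))"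
    for xs
  have "\<exists>xs. grown xs \<and> length xs = Suc k" if "Suc k \<le> card I" for k
    using that
  proof (induction k)
    case 0
    then show ?case using assms(2) by (intro exI[of _ "[r]"]) (simp add: grown_def)
  next
    case (Suc k)
    then obtain xs where xs: "grown xs" "length xs = Suc k" by auto
    then have "card (set xs) < card I" using Suc.prems by (simp add: grown_def distinct_card)
    then obtain i where "i \<in> I" "i \<notin> set xs" using xs(1)
      by (metis grown_def less_irrefl subsetI subset_antisym)
    then obtain u v where uv: "u \<in> set xs" "v \<notin> set xs" "v \<in> I" "R u v"
      using rtranclp_leaves_set[OF connected[of i], of "set xs"] xs(1) unfolding grown_def by metis
    then obtain j where j: "j < length xs" "xs ! j = u" by (auto simp: in_set_conv_nth)
    have "\<exists>h<l. R ((xs @ [v]) ! h) ((xs @ [v]) ! l)" if l: "l < length (xs @ [v])" "0 < l" for l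
    proof (cases "l < length xs")
      case True
      then obtain h where "h < l" "R (xs ! h) (xs ! l)" using xs(1) l(2) by (auto simp: grown_def)
      then show ?thesis using True by (intro exI[of _ h]) (simp add: nth_append)
    next
      case False
      then show ?thesis using j uv(4) l(1) by (intro exI[of _ j]) (simp add: nth_append)
    qed
    then have "grown (xs @ [v])" using xs(1) uv by (simp add: grown_def)
    then show ?case using xs(2) by (intro exI[of _ "xs @ [v]"]) simp
  qed
  moreover have "0 < card I" using assms(1,2) by (auto simp: card_gt_0_iff)
  ultimately obtain xs where xs: "grown xs" "length xs = card I" by (metis Suc_pred order_refl)
  then have "set xs = I" using assms(1) by (intro card_subset_eq) (auto simp: grown_def distinct_card)
  then show ?thesis using that[of xs] xs(1) by (auto simp: grown_def)
qed

definition nerve_connected :: "'i set \<Rightarrow> ('i \<Rightarrow> 'a set) \<Rightarrow> bool" where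
  "nerve_connected I X \<longleftrightarrow>
     (\<exists>r\<in>I. \<forall>i\<in>I. (\<lambda>i j. i \<in> I \<and> j \<in> I \<and> X i \<inter> X j \<noteq> {})\<^sup>*\<^sup>* r i)"

lemma bij_betw_edge_pairs_nerve_edges:
  assumes "bij_betw f {..<m} I"
  shows "bij_betw (\<lambda>(i,j). {f i, f j}) (edge_pairs m (X \<circ> f)) (nerve_edges I X)"
proof (rule bij_betw_imageI)
  have inj: "f i = f j \<longleftrightarrow> i = j" if "i < m" "j < m" for i j
    using assms that by (auto simp: bij_betw_def inj_on_def)
  show "inj_on (\<lambda>(i,j). {f i, f j}) (edge_pairs m (X \<circ> f))"
    by (auto simp: inj_on_def edge_pairs_def doubleton_eq_iff inj)
  show "(\<lambda>(i,j). {f i, f j}) ` edge_pairs m (X \<circ> f) = nerve_edges I X"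
  proof (intro equalityI subsetI)
    fix e assume "e \<in> nerve_edges I X"
    then obtain i j where "i < m" "j < m" "e = {f i, f j}" "f i \<noteq> f j" "X (f i) \<inter> X (f j) \<noteq> {}"
      using assms by (auto simp: nerve_edges_def bij_betw_def)
    then have "(min i j, max i j) \<in> edge_pairs m (X \<circ> f)" "{f (min i j), f (max i j)} = e"
      by (auto simp: edge_pairs_def min_def max_def le_less)
    then show "e \<in> (\<lambda>(i,j). {f i, f j}) ` edge_pairs m (X \<circ> f)" by force
  next
    fix e assume "e \<in> (\<lambda>(i,j). {f i, f j}) ` edge_pairs m (X \<circ> f)"
    then obtain i j where "i < j" "j < m" "e = {f i, f j}" "X (f i) \<inter> X (f j) \<noteq> {}"
      by (auto simp: edge_pairs_def)
    moreover have "f i \<in> I" "f j \<in> I" using calculation assms by (auto simp: bij_betw_def)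
    ultimately show "e \<in> nerve_edges I X" using inj[of i j] unfolding nerve_edges_def by force
  qed
qed

lemma graph_AR_cover_reindex:
  assumes "bij_betw f J I" "graph_AR_cover I X"
  shows "graph_AR_cover J (X \<circ> f)"
proof -
  have "finite J" using bij_betw_finite[OF assms(1)] assms(2) by (simp add: graph_AR_cover_def)
  moreover have "f i \<in> I" "f i = f j \<longleftrightarrow> i = j" if "i \<in> J" "j \<in> J" for i j
    using assms(1) that by (auto simp: bij_betw_def inj_on_def)
  ultimately show ?thesis using assms(2) unfolding graph_AR_cover_def by (simp add: comp_def)
qed

theorem graph_AR_cover_homotopy_eqv_bouquet:
  assumes cover: "graph_AR_cover I X" and connected: "nerve_connected I X"
    and "card I \<le> card (nerve_edges I X)"
  shows "(\<Union>i\<in>I. X i) homotopy_eqv bouquet (card (nerve_edges I X) + 1 - card I)"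
proof -
  have "finite I" using cover by (simp add: graph_AR_cover_def)
  obtain r where r: "r \<in> I" "\<And>i. i \<in> I \<Longrightarrow> (\<lambda>i j. i \<in> I \<and> j \<in> I \<and> X i \<inter> X j \<noteq> {})\<^sup>*\<^sup>* r i"
    using connected unfolding nerve_connected_def by blast
  obtain xs where xs: "distinct xs" "set xs = I"
    "\<And>k. \<lbrakk>0 < k; k < length xs\<rbrakk> \<Longrightarrow> \<exists>j<k. X (xs ! j) \<inter> X (xs ! k) \<noteq> {}"
    using connected_enumeration[OF \<open>finite I\<close> r] by metis
  obtain parent where parent:
    "\<And>k. \<lbrakk>0 < k; k < length xs\<rbrakk> \<Longrightarrow> parent k < k \<and> X (xs ! parent k) \<inter> X (xs ! k) \<noteq> {}"
    using xs(3) by metis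
  let ?m = "length xs" and ?X = "X \<circ> (!) xs"
  have bij: "bij_betw ((!) xs) {..<?m} I" using bij_betw_nth[OF xs(1)] xs(2) by simp
  have "graph_AR_cover {..<?m} ?X"
    by (rule graph_AR_cover_reindex[OF bij cover])
  then interpret rooted_telescope_cover ?m ?X parent
    using parent r(1) xs(2) by unfold_locales auto
  have "card (edge_pairs ?m ?X) = card (nerve_edges I X)"
    by (rule bij_betw_same_card[OF bij_betw_edge_pairs_nerve_edges[OF bij]])
  moreover have "?m = card I" using xs(1,2) distinct_card by fastforce
  moreover have "(\<Union>i<?m. ?X i) = (\<Union>i\<in>I. X i)"
    unfolding bij_betw_imp_surj_on[OF bij, symmetric] by simp
  ultimately show ?thesis using homotopy_eqv_bouquet assms(3) by simp
qed

section \<open>Covers whose nerve is a crown graph\<close>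

definition crown_AR_cover :: "nat \<Rightarrow> (nat \<Rightarrow> 'a::euclidean_space set) \<Rightarrow> (nat \<Rightarrow> 'a set) \<Rightarrow> bool" where
  "crown_AR_cover n U W \<longleftrightarrow>
     (\<forall>i<n. closed (U i) \<and> AR (U i) \<and> closed (W i) \<and> AR (W i) \<and> U i \<inter> W i = {}) \<and>
     (\<forall>i<n. \<forall>j<n. i \<noteq> j \<longrightarrow> U i \<inter> U j = {} \<and> W i \<inter> W j = {} \<and> AR (U i \<inter> W j))"

context
  fixes n :: nat and U W :: "nat \<Rightarrow> 'a::euclidean_space set"
  assumes crown: "crown_AR_cover n U W"
begin

fun crown_adjacent :: "nat + nat \<Rightarrow> nat + nat \<Rightarrow> bool" where
  "crown_adjacent (Inl i) (Inr j) \<longleftrightarrow> i \<noteq> j"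
| "crown_adjacent (Inr i) (Inl j) \<longleftrightarrow> i \<noteq> j"
| "crown_adjacent _ _ \<longleftrightarrow> False"

abbreviation crown_vertices :: "(nat + nat) set" where "crown_vertices \<equiv> {..<n} <+> {..<n}"
abbreviation crown_piece :: "nat + nat \<Rightarrow> 'a set" where "crown_piece \<equiv> case_sum U W"

lemma AR_crown_piece_Int:
  "\<lbrakk>x \<in> crown_vertices; y \<in> crown_vertices; crown_adjacent x y\<rbrakk> \<Longrightarrow> AR (crown_piece x \<inter> crown_piece y)"
  using crown unfolding crown_AR_cover_def by (cases x; cases y) (auto simp: Int_commute)

lemma crown_piece_Int_empty_iff:
  assumes "x \<in> crown_vertices" "y \<in> crown_vertices" "x \<noteq> y"
  shows "crown_piece x \<inter> crown_piece y = {} \<longleftrightarrow> \<not> crown_adjacent x y"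
proof
  show "\<not> crown_adjacent x y \<Longrightarrow> crown_piece x \<inter> crown_piece y = {}"
    using assms(1,2) by (elim PlusE) (use crown assms(3) in \<open>simp_all add: crown_AR_cover_def Int_commute\<close>)
qed (use AR_crown_piece_Int[OF assms(1,2)] in \<open>auto simp: AR_ANR\<close>)

lemma crown_graph_AR_cover: "graph_AR_cover crown_vertices crown_piece"
proof -
  have "crown_piece x \<inter> crown_piece y \<inter> crown_piece z = {}"
    if "x \<in> crown_vertices" "y \<in> crown_vertices" "z \<in> crown_vertices" "x \<noteq> y" "y \<noteq> z" "x \<noteq> z" for x y z
  proof -
    have "\<not> crown_adjacent x y \<or> \<not> crown_adjacent y z \<or> \<not> crown_adjacent x z"
      by (cases x; cases y; cases z) auto
    then show ?thesis using crown_piece_Int_empty_iff that by blast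
  qed
  moreover have "closed (crown_piece x) \<and> AR (crown_piece x)" if "x \<in> crown_vertices" for x
    using that crown by (cases x) (auto simp: crown_AR_cover_def)
  ultimately show ?thesis
    unfolding graph_AR_cover_def using AR_crown_piece_Int crown_piece_Int_empty_iff
    by (simp add: finite_Plus)
qed

lemma bij_betw_crown_edges:
  "bij_betw (\<lambda>(i,j). {Inl i, Inr j}) (SIGMA i:{..<n}. {..<n} - {i}) (nerve_edges crown_vertices crown_piece)"
proof (rule bij_betw_imageI)
  show "inj_on (\<lambda>(i,j). {Inl i, Inr j}) (SIGMA i:{..<n}. {..<n} - {i})"
    by (auto simp: inj_on_def doubleton_eq_iff)
  have "x \<in> crown_vertices \<and> y \<in> crown_vertices \<and> x \<noteq> y \<and> crown_piece x \<inter> crown_piece y \<noteq> {} \<longleftrightarrow>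
      x \<in> crown_vertices \<and> y \<in> crown_vertices \<and> x \<noteq> y \<and> crown_adjacent x y" for x y
    using crown_piece_Int_empty_iff[of x y] by metis
  then have "nerve_edges crown_vertices crown_piece =
      {{x,y} | x y. x \<in> crown_vertices \<and> y \<in> crown_vertices \<and> x \<noteq> y \<and> crown_adjacent x y}"
    by (simp only: nerve_edges_def)
  also have "\<dots> = (\<lambda>(i,j). {Inl i, Inr j}) ` (SIGMA i:{..<n}. {..<n} - {i})"
  proof (intro equalityI subsetI)
    fix e assume "e \<in> {{x,y} | x y. x \<in> crown_vertices \<and> y \<in> crown_vertices \<and> x \<noteq> y \<and> crown_adjacent x y}"
    then obtain x y where e: "e = {x,y}" "x \<in> crown_vertices" "y \<in> crown_vertices" "crown_adjacent x y"
      by blast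
    then obtain i j where "i < n" "j < n" "i \<noteq> j" "e = {Inl i, Inr j}"
      by (cases x; cases y) (auto simp: insert_commute)
    then show "e \<in> (\<lambda>(i,j). {Inl i, Inr j}) ` (SIGMA i:{..<n}. {..<n} - {i})" by force
  qed force
  finally show "(\<lambda>(i,j). {Inl i, Inr j}) ` (SIGMA i:{..<n}. {..<n} - {i}) =
    nerve_edges crown_vertices crown_piece" ..
qed

lemma crown_nerve_connected:
  assumes "3 \<le> n"
  shows "nerve_connected crown_vertices crown_piece"
proof -
  define R where
    "R x y \<longleftrightarrow> x \<in> crown_vertices \<and> y \<in> crown_vertices \<and> crown_piece x \<inter> crown_piece y \<noteq> {}" for x y
  have edge: "R (Inl i) (Inr j)" "R (Inr j) (Inl i)" if "i < n" "j < n" "i \<noteq> j" for i j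
    using that crown_piece_Int_empty_iff[of "Inl i" "Inr j"] by (auto simp: R_def Int_commute)
  have reach_U: "R\<^sup>*\<^sup>* (Inl 0) (Inl i)" if "i < n" for i
  proof -
    define j :: nat where "j = (if i = 1 then 2 else 1)"
    have "j < n" "j \<noteq> 0" "j \<noteq> i" using assms by (auto simp: j_def)
    then have "R (Inl 0) (Inr j)" "R (Inr j) (Inl i)" using edge[of 0 j] edge[of i j] that assms by auto
    then show ?thesis by (meson converse_rtranclp_into_rtranclp r_into_rtranclp)
  qed
  moreover have "R\<^sup>*\<^sup>* (Inl 0) (Inr j)" if "j < n" for j
  proof -
    define i :: nat where "i = (if j = 0 then 1 else 0)"
    have "i < n" "i \<noteq> j" using assms by (auto simp: i_def)
    then have "R (Inl i) (Inr j)" using edge(1) that by blast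
    then show ?thesis using reach_U[OF \<open>i < n\<close>] by (meson rtranclp.rtrancl_into_rtrancl)
  qed
  ultimately show ?thesis
    unfolding nerve_connected_def R_def[symmetric] using assms by (intro bexI[of _ "Inl 0"]) auto
qed

theorem crown_AR_cover_homotopy_eqv_bouquet:
  assumes "3 \<le> n"
  shows "((\<Union>i<n. U i) \<union> (\<Union>i<n. W i)) homotopy_eqv bouquet (n^2 - 3*n + 1)"
proof -
  have "card (nerve_edges crown_vertices crown_piece) = card (SIGMA i:{..<n}. {..<n} - {i})"
    using bij_betw_same_card[OF bij_betw_crown_edges] by simp
  also have "\<dots> = n * (n - 1)" by simp
  finally have edges: "card (nerve_edges crown_vertices crown_piece) = n * (n - 1)" .
  obtain m where m: "n = m + 3" using assms le_Suc_ex by (metis add.commute)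
  have "card crown_vertices \<le> card (nerve_edges crown_vertices crown_piece)"
    "card (nerve_edges crown_vertices crown_piece) + 1 - card crown_vertices = n^2 - 3*n + 1"
    unfolding edges by (simp_all add: m card_Plus power2_eq_square algebra_simps)
  moreover have "(\<Union>x\<in>crown_vertices. crown_piece x) = (\<Union>i<n. U i) \<union> (\<Union>i<n. W i)" by (auto simp: Plus_def)
  ultimately show ?thesis
    using graph_AR_cover_homotopy_eqv_bouquet[OF crown_graph_AR_cover crown_nerve_connected[OF assms]]
    by simp
qed

end

section \<open>Diagrams and ranks\<close>

definition bar_count :: "(real \<times> ereal) multiset \<Rightarrow> real \<Rightarrow> real \<Rightarrow> nat" where
  "bar_count P r s = size {#p \<in># P. fst p \<le> r \<and> ereal s < snd p#}"

definition sublevel_rank :: "'v set set \<Rightarrow> real^'v \<Rightarrow> real \<Rightarrow> real \<Rightarrow> nat" where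
  "sublevel_rank E z r s = comp_count E (sub_le z r) (sub_le z s)"

definition predecessor_in :: "real set \<Rightarrow> real \<Rightarrow> real \<Rightarrow> bool" where
  "predecessor_in V a b \<longleftrightarrow> a < b \<and> (\<forall>x\<in>V. x < b \<longrightarrow> x \<le> a)"

lemma predecessor_in_le_iff: "predecessor_in V a b \<Longrightarrow> x \<in> V \<Longrightarrow> x \<le> a \<longleftrightarrow> x < b"
  by (auto simp: predecessor_in_def)

lemma predecessor_in_exists:
  assumes "finite V" "e < b"
  obtains a where "e \<le> a" "predecessor_in V a b"
proof (rule that)
  let ?X = "insert e {x \<in> V. x < b}"
  show "e \<le> Max ?X" "predecessor_in V (Max ?X) b"
    using assms by (auto simp: predecessor_in_def)
qed

lemma sub_lt_eq_sub_le:
  assumes "predecessor_in V a b" "range (($) z) \<subseteq> V"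
  shows "sub_lt z b = sub_le z a"
  using assms predecessor_in_le_iff[OF assms(1)] by (auto simp: sub_lt_def sub_le_def)

definition bar_ends :: "(real \<times> ereal) multiset \<Rightarrow> real set" where
  "bar_ends P = fst ` set_mset P \<union> {d. ereal d \<in> snd ` set_mset P}"

lemma finite_bar_ends: "finite (bar_ends P)"
proof -
  have "{d. ereal d \<in> snd ` set_mset P} \<subseteq> real_of_ereal ` snd ` set_mset P" by force
  then have "finite {d. ereal d \<in> snd ` set_mset P}" by (rule finite_subset) simp
  then show ?thesis unfolding bar_ends_def by simp
qed

lemma bar_count_add_mset:
  "bar_count (add_mset p P) r s = of_bool (fst p \<le> r \<and> ereal s < snd p) + bar_count P r s"
  by (simp add: bar_count_def)

lemma count_eq_bar_count_differences:
  assumes "predecessor_in V b' b" "predecessor_in V d' d" "bar_ends P \<subseteq> V"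
  shows "int (count P (b, ereal d)) = int (bar_count P b d') - int (bar_count P b' d')
    - int (bar_count P b d) + int (bar_count P b' d)"
  using assms(3)
proof (induction P)
  case empty
  then show ?case by (simp add: bar_count_def)
next
  case (add p P)
  obtain x y where p: "p = (x,y)" by (cases p)
  have x: "x \<le> b' \<longleftrightarrow> x < b"
    using add.prems predecessor_in_le_iff[OF assms(1)] by (auto simp: bar_ends_def p)
  have y: "ereal d' < y \<longleftrightarrow> ereal d \<le> y"
  proof (cases y)
    case (real t)
    then have "t \<in> V" using add.prems by (auto simp: bar_ends_def p)
    then show ?thesis using predecessor_in_le_iff[OF assms(2)] real by (auto simp: not_le[symmetric])
  qed auto
  have "bar_ends P \<subseteq> V" using add.prems by (auto simp: bar_ends_def)
  then show ?case
    using add.IH x y by (auto simp: bar_count_add_mset p of_bool_def)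
qed

lemma count_infinite_eq_bar_count_difference:
  assumes "predecessor_in V b' b" "bar_ends P \<subseteq> V" "\<forall>x\<in>V. x \<le> s"
  shows "int (count P (b, \<infinity>)) = int (bar_count P b s) - int (bar_count P b' s)"
  using assms(2)
proof (induction P)
  case empty
  then show ?case by (simp add: bar_count_def)
next
  case (add p P)
  obtain x y where p: "p = (x,y)" by (cases p)
  have x: "x \<le> b' \<longleftrightarrow> x < b"
    using add.prems predecessor_in_le_iff[OF assms(1)] by (auto simp: bar_ends_def p)
  have y: "ereal s < y \<longleftrightarrow> y = \<infinity>"
    using add.prems assms(3) by (cases y) (auto simp: bar_ends_def p not_less)
  have "bar_ends P \<subseteq> V" using add.prems by (auto simp: bar_ends_def)
  then show ?case
    using add.IH x y by (auto simp: bar_count_add_mset p of_bool_def)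
qed

lemma ph0_eq_rank_differences:
  assumes "predecessor_in V b' b" "predecessor_in V d' d" "range (($) z) \<subseteq> V" "b < d"
  shows "ph0 E z (b, ereal d) = int (sublevel_rank E z b d') - int (sublevel_rank E z b' d')
    - int (sublevel_rank E z b d) + int (sublevel_rank E z b' d)"
  using assms by (simp add: ph0_def sublevel_rank_def sub_lt_eq_sub_le)

lemma ph0_infinite_eq_rank_difference:
  assumes "predecessor_in V b' b" "range (($) z) \<subseteq> V" "\<forall>x\<in>V. x \<le> s"
  shows "ph0 E z (b, \<infinity>) = int (sublevel_rank E z b s) - int (sublevel_rank E z b' s)"
proof -
  have "sub_le z s = UNIV" using assms(2,3) by (auto simp: sub_le_def)
  then show ?thesis
    using sub_lt_eq_sub_le[OF assms(1,2)] by (simp add: ph0_def sublevel_rank_def flip: infinity_ereal_def)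
qed

lemma sublevel_rank_cong:
  assumes "range (($) z) \<subseteq> V" "\<forall>x\<in>V. x \<le> r \<longleftrightarrow> x \<le> r'"
  shows "sublevel_rank E z r s = sublevel_rank E z r' s"
proof -
  have "sub_le z r = sub_le z r'" using assms by (auto simp: sub_le_def)
  then show ?thesis by (simp add: sublevel_rank_def)
qed

lemma bar_count_cong:
  assumes "bar_ends P \<subseteq> V" "\<forall>x\<in>V. x \<le> r \<longleftrightarrow> x \<le> r'"
  shows "bar_count P r s = bar_count P r' s"
proof -
  have "fst p \<le> r \<longleftrightarrow> fst p \<le> r'" if "p \<in># P" for p using assms that by (auto simp: bar_ends_def)
  then show ?thesis unfolding bar_count_def by (metis (mono_tags, lifting) filter_mset_cong)
qed

lemma greatest_le_in_finite:
  fixes V :: "real set"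
  assumes "finite V" "{x \<in> V. x \<le> r} \<noteq> {}"
  obtains b b' where "b \<le> r" "\<forall>x\<in>V. x \<le> r \<longleftrightarrow> x \<le> b" "predecessor_in V b' b"
    "card {x \<in> V. x \<le> b'} < card {x \<in> V. x \<le> r}"
proof -
  define b where "b = Max {x \<in> V. x \<le> r}"
  have "b \<in> {x \<in> V. x \<le> r}" using Max_in[OF _ assms(2)] assms(1) by (simp add: b_def)
  then have b: "b \<in> V" "b \<le> r" by auto
  have same_below: "x \<le> r \<longleftrightarrow> x \<le> b" if "x \<in> V" for x
    using that assms(1) b(2) Max_ge[of "{x \<in> V. x \<le> r}" x] by (auto simp: b_def)
  obtain b' where b': "predecessor_in V b' b" using predecessor_in_exists[OF assms(1), of "b - 1" b] by auto
  then have "b \<in> {x \<in> V. x \<le> r} - {x \<in> V. x \<le> b'}" "{x \<in> V. x \<le> b'} \<subseteq> {x \<in> V. x \<le> r}"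
    using b by (auto simp: predecessor_in_def)
  then have "{x \<in> V. x \<le> b'} \<subset> {x \<in> V. x \<le> r}" by blast
  then have "card {x \<in> V. x \<le> b'} < card {x \<in> V. x \<le> r}" using assms(1) by (simp add: psubset_card_mono)
  then show ?thesis using that b(2) same_below b' by blast
qed

lemma least_gt_in_finite:
  fixes V :: "real set"
  assumes "finite V" "{x \<in> V. s < x} \<noteq> {}"
  obtains d where "predecessor_in V s d" "card {x \<in> V. d < x} < card {x \<in> V. s < x}"
proof -
  define d where "d = Min {x \<in> V. s < x}"
  have "d \<in> {x \<in> V. s < x}" using Min_in[OF _ assms(2)] assms(1) by (simp add: d_def)
  then have d: "d \<in> V" "s < d" by auto
  have "x \<le> s" if "x \<in> V" "x < d" for x
    using that assms(1) Min_le[of "{x \<in> V. s < x}" x] by (auto simp: d_def not_le[symmetric])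
  then have "predecessor_in V s d" using d(2) by (simp add: predecessor_in_def)
  moreover have "d \<in> {x \<in> V. s < x} - {x \<in> V. d < x}" "{x \<in> V. d < x} \<subseteq> {x \<in> V. s < x}" using d by auto
  then have "{x \<in> V. d < x} \<subset> {x \<in> V. s < x}" by blast
  then have "card {x \<in> V. d < x} < card {x \<in> V. s < x}" using assms(1) by (simp add: psubset_card_mono)
  ultimately show ?thesis using that by blast
qed

text \<open>Ranks and bar counts have the same mixed differences, and the value at a pair of levels is determined by
  them through the values with fewer thresholds below the first or above the second level.\<close>

context
  fixes E :: "'v::finite set set" and z :: "real^'v" and P :: "(real \<times> ereal) multiset" and V :: "real set"
  assumes PH0: "PH0_eq E z P" and V: "finite V" "range (($) z) \<subseteq> V" "bar_ends P \<subseteq> V"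
begin

lemma sublevel_rank_eq_from_differences:
  assumes b: "predecessor_in V b' b" "b \<le> s"
    and before: "\<And>t. s \<le> t \<Longrightarrow> sublevel_rank E z b' t = bar_count P b' t"
    and after: "\<And>d. \<lbrakk>predecessor_in V s d; card {x \<in> V. d < x} < card {x \<in> V. s < x}\<rbrakk> \<Longrightarrow>
      sublevel_rank E z b d = bar_count P b d"
  shows "sublevel_rank E z b s = bar_count P b s"
proof -
  have ph0: "ph0 E z p = int (count P p)" for p using PH0 unfolding PH0_eq_def by blast
  show ?thesis
  proof (cases "{x \<in> V. s < x} = {}")
    case True
    then have "\<forall>x\<in>V. x \<le> s" by auto
    then show ?thesis
      using ph0_infinite_eq_rank_difference[OF b(1) V(2)] count_infinite_eq_bar_count_difference[OF b(1) V(3)]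
        ph0[of "(b, \<infinity>)"] before[of s] by simp
  next
    case False
    obtain d where d: "predecessor_in V s d" "card {x \<in> V. d < x} < card {x \<in> V. s < x}"
      using least_gt_in_finite[OF V(1) False] .
    then have "s < d" by (simp add: predecessor_in_def)
    then show ?thesis
      using ph0_eq_rank_differences[OF b(1) d(1) V(2)] count_eq_bar_count_differences[OF b(1) d(1) V(3)]
        ph0[of "(b, ereal d)"] before[of s] before[of d] after[OF d] b(2) by simp
  qed
qed

lemma PH0_eq_imp_sublevel_rank_eq_within:
  assumes "r \<le> s"
  shows "sublevel_rank E z r s = bar_count P r s"
  using assms
proof (induction "card {x \<in> V. x \<le> r} + card {x \<in> V. s < x}" arbitrary: r s rule: less_induct)
  case less
  show ?case
  proof (cases "{x \<in> V. x \<le> r} = {}")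
    case True
    then have "sub_le z r = {}" "{#p \<in># P. fst p \<le> r \<and> ereal s < snd p#} = {#}"
      using V(2,3) by (auto simp: sub_le_def bar_ends_def filter_mset_eq_conv)
    then show ?thesis by (simp add: sublevel_rank_def bar_count_def comp_count_def)
  next
    case False
    obtain b b' where b: "b \<le> r" "\<forall>x\<in>V. x \<le> r \<longleftrightarrow> x \<le> b" "predecessor_in V b' b"
      and fewer: "card {x \<in> V. x \<le> b'} < card {x \<in> V. x \<le> r}"
      using greatest_le_in_finite[OF V(1) False] .
    have "sublevel_rank E z b s = bar_count P b s"
    proof (rule sublevel_rank_eq_from_differences[OF b(3)])
      show "sublevel_rank E z b' t = bar_count P b' t" if "s \<le> t" for t
      proof (rule less.hyps)
        have "card {x \<in> V. t < x} \<le> card {x \<in> V. s < x}" using that V(1) by (intro card_mono) auto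
        then show "card {x \<in> V. x \<le> b'} + card {x \<in> V. t < x} < card {x \<in> V. x \<le> r} + card {x \<in> V. s < x}"
          using fewer by simp
        show "b' \<le> t" using b(1,3) less.prems that by (simp add: predecessor_in_def)
      qed
      have "{x \<in> V. x \<le> b} = {x \<in> V. x \<le> r}" using b(2) by auto
      then show "sublevel_rank E z b d = bar_count P b d"
        if "predecessor_in V s d" "card {x \<in> V. d < x} < card {x \<in> V. s < x}" for d
        using less.hyps[of b d] that b(1) less.prems by (simp add: predecessor_in_def)
    qed (use b(1) less.prems in simp)
    then show ?thesis
      using sublevel_rank_cong[OF V(2) b(2)] bar_count_cong[OF V(3) b(2)] by metis
  qed
qed

end

lemma PH0_eq_imp_sublevel_rank_eq:
  fixes z :: "real^'v::finite"
  assumes "PH0_eq E z P" "r \<le> s"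
  shows "sublevel_rank E z r s = bar_count P r s"
  using assms by (intro PH0_eq_imp_sublevel_rank_eq_within[of _ _ _ "range (($) z) \<union> bar_ends P"])
    (simp_all add: finite_bar_ends)

lemma sublevel_rank_eq_imp_PH0_eq:
  fixes z :: "real^'v::finite"
  assumes rank: "\<And>r s. r \<le> s \<Longrightarrow> sublevel_rank E z r s = bar_count P r s"
    and bars: "\<And>b d. (b,d) \<in># P \<Longrightarrow> ereal b < d"
  shows "PH0_eq E z P"
  unfolding PH0_eq_def
proof
  define V where "V = range (($) z) \<union> bar_ends P"
  have V: "finite V" "range (($) z) \<subseteq> V" "bar_ends P \<subseteq> V" by (auto simp: V_def finite_bar_ends)
  fix p :: "real \<times> ereal"
  obtain b x where p: "p = (b,x)" by (cases p)
  obtain b' where b': "predecessor_in V b' b" using predecessor_in_exists[OF V(1), of "b - 1" b] by auto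
  then have "b' < b" by (simp add: predecessor_in_def)
  show "ph0 E z p = int (count P p)"
  proof (cases "ereal b < x")
    case False
    then have "p \<notin># P" using bars[of b x] by (auto simp: p)
    moreover have "ph0 E z p = 0"
      using False by (cases x) (auto simp: p ph0_def simp flip: MInfty_eq_minfinity)
    ultimately show ?thesis by (simp add: count_eq_zero_iff)
  next
    case True
    then consider (finite) d where "x = ereal d" "b < d" | (infinite) "x = \<infinity>" by (cases x) auto
    then show ?thesis
    proof cases
      case finite
      then obtain d' where d': "b \<le> d'" "predecessor_in V d' d" using predecessor_in_exists[OF V(1)]
        by blast
      then show ?thesis
        using ph0_eq_rank_differences[OF b' d'(2) V(2) finite(2)]
          count_eq_bar_count_differences[OF b' d'(2) V(3)]
          rank \<open>b' < b\<close> finite by (simp add: p)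
    next
      case infinite
      define s where "s = Max (insert b V)"
      have "\<forall>x\<in>V. x \<le> s" "b \<le> s" using V(1) by (auto simp: s_def)
      then show ?thesis
        using ph0_infinite_eq_rank_difference[OF b' V(2)] count_infinite_eq_bar_count_difference[OF b' V(3)]
          rank \<open>b' < b\<close> by (simp add: p infinite)
    qed
  qed
qed

theorem PH0_eq_iff_sublevel_rank:
  fixes z :: "real^'v::finite"
  assumes "\<And>b d. (b,d) \<in># P \<Longrightarrow> ereal b < d"
  shows "PH0_eq E z P \<longleftrightarrow> (\<forall>r s. r \<le> s \<longrightarrow> sublevel_rank E z r s = bar_count P r s)"
  using PH0_eq_imp_sublevel_rank_eq sublevel_rank_eq_imp_PH0_eq[OF _ assms] by blast

section \<open>Vectors with two bars\<close>

definition linked :: "'v set set \<Rightarrow> 'v set \<Rightarrow> 'v \<Rightarrow> 'v \<Rightarrow> bool" where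
  "linked E S = (\<lambda>a b. a \<in> S \<and> b \<in> S \<and> {a, b} \<in> E)\<^sup>*\<^sup>*"

lemma linked_refl [simp]: "linked E S v v"
  by (simp add: linked_def)

lemma linked_trans: "linked E S u v \<Longrightarrow> linked E S v w \<Longrightarrow> linked E S u w"
  by (simp add: linked_def)

lemma linked_edge: "u \<in> S \<Longrightarrow> v \<in> S \<Longrightarrow> {u, v} \<in> E \<Longrightarrow> linked E S u v"
  by (auto simp: linked_def)

lemma linked_sym: "linked E S v w \<Longrightarrow> linked E S w v"
  unfolding linked_def
proof (induction rule: rtranclp_induct)
  case (step y z)
  then show ?case by (intro converse_rtranclp_into_rtranclp[OF _ step.IH]) (simp add: insert_commute)
qed simp

lemma linked_mono: "linked E S v w \<Longrightarrow> S \<subseteq> S' \<Longrightarrow> linked E S' v w"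
  unfolding linked_def by (erule rtranclp_mono[THEN predicate2D, rotated]) blast

lemma linked_in: "linked E S v w \<Longrightarrow> v \<in> S \<Longrightarrow> w \<in> S"
  unfolding linked_def by (induction rule: rtranclp_induct) auto

definition component :: "'v set set \<Rightarrow> 'v set \<Rightarrow> 'v \<Rightarrow> 'v set" where
  "component E S v = {w \<in> S. linked E S v w}"

lemma comp_count_eq_card_component: "comp_count E A S = card (component E S ` A)"
  by (simp add: comp_count_def component_def linked_def)

lemma component_eq_iff:
  assumes "w \<in> S"
  shows "component E S v = component E S w \<longleftrightarrow> linked E S v w"
proof
  assume "component E S v = component E S w"
  moreover have "w \<in> component E S w" using assms by (simp add: component_def)
  ultimately have "w \<in> component E S v" by simp
  then show "linked E S v w" by (simp add: component_def)
next
  assume "linked E S v w"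
  then have "linked E S v x \<longleftrightarrow> linked E S w x" for x
    using linked_trans linked_sym by metis
  then show "component E S v = component E S w" by (simp add: component_def)
qed

lemma comp_count_eq_1:
  assumes "a \<in> A" "A \<subseteq> S" "\<And>v. v \<in> A \<Longrightarrow> linked E S v a"
  shows "comp_count E A S = 1"
proof -
  have "component E S v \<in> {component E S a}" if "v \<in> A" for v
    using that assms component_eq_iff[of a S E v] by auto
  then have "component E S ` A = {component E S a}" using assms(1) by blast
  then show ?thesis by (simp add: comp_count_eq_card_component)
qed

lemma comp_count_eq_2:
  assumes "a \<in> A" "b \<in> A" "A \<subseteq> S" "\<not> linked E S a b"
    and "\<And>v. v \<in> A \<Longrightarrow> linked E S v a \<or> linked E S v b"
  shows "comp_count E A S = 2"
proof -
  have ab: "a \<in> S" "b \<in> S" using assms(1-3) by auto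
  then have "component E S v \<in> {component E S a, component E S b}" if "v \<in> A" for v
    using assms(5)[OF that] component_eq_iff[of a S E v] component_eq_iff[of b S E v] by auto
  then have "component E S ` A = {component E S a, component E S b}" using assms(1,2) by blast
  moreover have "component E S a \<noteq> component E S b" using component_eq_iff[OF ab(2), of E a] assms(4)
    by simp
  ultimately show ?thesis by (simp add: comp_count_eq_card_component)
qed

lemma comp_count_1_linked:
  assumes "comp_count E A S = 1" "A \<subseteq> S" "v \<in> A" "w \<in> A"
  shows "linked E S v w"
proof -
  obtain C where "component E S ` A = {C}"
    using assms(1) card_1_singletonE unfolding comp_count_eq_card_component by blast
  then have "component E S v = component E S w" using assms(3,4) by (metis imageI singletonD)
  then show ?thesis using component_eq_iff[of w S E v] assms(2,4) by blast
qed

lemma comp_count_2_linked: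
  assumes "comp_count E A S = 2" "A \<subseteq> S" "a \<in> A" "b \<in> A" "v \<in> A" "\<not> linked E S a b"
  shows "linked E S v a \<or> linked E S v b"
proof (rule ccontr)
  assume not_linked: "\<not> ?thesis"
  have "a \<in> S" "b \<in> S" using assms(2-4) by auto
  then have "component E S a \<noteq> component E S b" "component E S v \<noteq> component E S a"
    "component E S v \<noteq> component E S b"
    using assms(6) not_linked by (simp_all add: component_eq_iff)
  then have "card {component E S a, component E S b, component E S v} = 3" by auto
  moreover have "card {component E S a, component E S b, component E S v} \<le> card (component E S ` A)"
    using assms(1,3-5) by (intro card_mono card_ge_0_finite) (auto simp: comp_count_eq_card_component)
  ultimately show False using assms(1) by (simp add: comp_count_eq_card_component)
qed

definition two_wells :: "'v set set \<Rightarrow> real^'v \<Rightarrow> 'v \<Rightarrow> real \<Rightarrow> 'v \<Rightarrow> real \<Rightarrow> real \<Rightarrow> bool" where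
  "two_wells E z a \<alpha> b \<beta> \<gamma> \<longleftrightarrow> z $ a = \<alpha> \<and> z $ b = \<beta> \<and>
     linked E (sub_le z \<gamma>) a b \<and> \<not> linked E (sub_lt z \<gamma>) a b \<and>
     (\<forall>v. linked E (sub_le z (z $ v)) v a \<or> linked E (sub_le z (z $ v)) v b)"

lemma sub_le_mono: "r \<le> s \<Longrightarrow> sub_le z r \<subseteq> sub_le z s"
  by (auto simp: sub_le_def)

lemma mem_sub_le [simp]: "v \<in> sub_le z r \<longleftrightarrow> z $ v \<le> r"
  by (simp add: sub_le_def)

context
  fixes E :: "'v::finite set set" and z :: "real^'v" and \<alpha> \<beta> \<gamma> :: real
  assumes order: "\<alpha> < \<beta>" "\<beta> < \<gamma>"
begin

lemma two_wells_linked_to_well: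
  assumes "two_wells E z a \<alpha> b \<beta> \<gamma>" "z $ v \<le> s"
  shows "linked E (sub_le z s) v a \<or> \<beta> \<le> z $ v \<and> linked E (sub_le z s) v b"
proof -
  have "linked E (sub_le z (z $ v)) v a \<or> linked E (sub_le z (z $ v)) v b" "z $ b = \<beta>"
    using assms(1) by (auto simp: two_wells_def)
  then show ?thesis
    using linked_mono[OF _ sub_le_mono[OF assms(2)]] linked_in[of E "sub_le z (z $ v)" v b] by fastforce
qed

lemma two_wells_lower_bound:
  assumes "two_wells E z a \<alpha> b \<beta> \<gamma>"
  shows "\<alpha> \<le> z $ v"
  using two_wells_linked_to_well[OF assms order_refl, of v] linked_in[of E "sub_le z (z $ v)" v a] assms order
  by (auto simp: two_wells_def)

lemma two_wells_imp_sublevel_rank: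
  assumes wells: "two_wells E z a \<alpha> b \<beta> \<gamma>" and "r \<le> s"
  shows "sublevel_rank E z r s = of_bool (\<alpha> \<le> r) + of_bool (\<beta> \<le> r \<and> s < \<gamma>)"
  unfolding sublevel_rank_def
proof -
  have ab: "z $ a = \<alpha>" "z $ b = \<beta>"
    and merge: "linked E (sub_le z \<gamma>) a b" "\<not> linked E (sub_lt z \<gamma>) a b"
    using wells by (auto simp: two_wells_def)
  note subset = sub_le_mono[OF \<open>r \<le> s\<close>]
  have linked: "linked E (sub_le z s) v a \<or> \<beta> \<le> r \<and> linked E (sub_le z s) v b" if "z $ v \<le> r" for v
    using two_wells_linked_to_well[OF wells, of v s] that \<open>r \<le> s\<close> by auto
  consider (empty) "r < \<alpha>" | (deep) "\<alpha> \<le> r" "r < \<beta>" | (merged) "\<alpha> \<le> r" "\<gamma> \<le> s" | (separate) "\<beta> \<le> r" "s < \<gamma>"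
    using \<open>r \<le> s\<close> order by linarith
  then show "comp_count E (sub_le z r) (sub_le z s) = of_bool (\<alpha> \<le> r) + of_bool (\<beta> \<le> r \<and> s < \<gamma>)"
  proof cases
    case empty
    then have "sub_le z r = {}"
      using two_wells_lower_bound[OF wells] by (auto simp: sub_le_def not_le intro: less_le_trans)
    then show ?thesis using empty order by (simp add: comp_count_def)
  next
    case deep
    then have "comp_count E (sub_le z r) (sub_le z s) = 1"
      using linked ab by (intro comp_count_eq_1[of a]) (auto simp: subset)
    then show ?thesis using deep by simp
  next
    case merged
    then have "linked E (sub_le z s) b a" using merge(1) sub_le_mono[of \<gamma> s z] linked_mono linked_sym
      by metis
    then have "comp_count E (sub_le z r) (sub_le z s) = 1"
      using merged linked ab by (intro comp_count_eq_1[of a]) (auto simp: subset intro: linked_trans)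
    then show ?thesis using merged by simp
  next
    case separate
    have "sub_le z s \<subseteq> sub_lt z \<gamma>" using separate by (auto simp: sub_lt_def)
    then have "\<not> linked E (sub_le z s) a b" using merge(2) linked_mono by metis
    then have "comp_count E (sub_le z r) (sub_le z s) = 2"
      using separate linked ab order by (intro comp_count_eq_2[of a _ b]) (auto simp: subset)
    then show ?thesis using separate order by simp
  qed
qed

context
  assumes rank: "\<And>r s. r \<le> s \<Longrightarrow> sublevel_rank E z r s = of_bool (\<alpha> \<le> r) + of_bool (\<beta> \<le> r \<and> s < \<gamma>)"
begin

lemma comp_count_of_rank:
  "r \<le> s \<Longrightarrow> comp_count E (sub_le z r) (sub_le z s) = of_bool (\<alpha> \<le> r) + of_bool (\<beta> \<le> r \<and> s < \<gamma>)"
  using rank[of r s] by (simp add: sublevel_rank_def)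

lemma lower_bound_of_rank: "\<alpha> \<le> z $ v"
proof (rule ccontr)
  assume "\<not> \<alpha> \<le> z $ v"
  then have "comp_count E (sub_le z (z $ v)) (sub_le z (z $ v)) = 0"
    using comp_count_of_rank[of "z $ v" "z $ v"] order by simp
  then show False by (auto simp: comp_count_eq_card_component card_eq_0_iff sub_le_def)
qed

lemma linked_outside_merge_interval:
  assumes "z $ v \<le> r" "z $ w \<le> r" "r < \<beta> \<or> \<gamma> \<le> r"
  shows "linked E (sub_le z r) v w"
proof (rule comp_count_1_linked[of E "sub_le z r"])
  show "comp_count E (sub_le z r) (sub_le z r) = 1"
    using comp_count_of_rank[of r r] lower_bound_of_rank[of v] assms by auto
qed (use assms in auto)

lemma separated_wells_of_rank:
  obtains a b where "z $ a = \<alpha>" "z $ b = \<beta>" "\<not> linked E (sub_lt z \<gamma>) a b"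
proof -
  have "sub_le z \<alpha> \<noteq> {}" using comp_count_of_rank[of \<alpha> \<alpha>] by (auto simp: comp_count_def)
  then obtain a where a: "z $ a = \<alpha>" using lower_bound_of_rank
    by (auto simp: sub_le_def intro: order_antisym)
  obtain s where s: "\<beta> \<le> s" "predecessor_in (range (($) z)) s \<gamma>"
    using predecessor_in_exists[of "range (($) z)" \<beta> \<gamma>] order by auto
  then have "s < \<gamma>" and sub_lt: "sub_lt z \<gamma> = sub_le z s"
    using sub_lt_eq_sub_le[OF s(2) order_refl] by (simp_all add: predecessor_in_def)
  have "comp_count E (sub_le z \<beta>) (sub_le z s) = 2"
    using comp_count_of_rank[of \<beta> s] s(1) \<open>s < \<gamma>\<close> order by simp
  then obtain b where b: "z $ b \<le> \<beta>" "\<not> linked E (sub_le z s) b a"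
    using comp_count_eq_1[of a "sub_le z \<beta>" "sub_le z s" E] sub_le_mono[OF s(1)] a order by fastforce
  moreover have "linked E (sub_le z (z $ b)) b a" if "z $ b < \<beta>"
    using linked_outside_merge_interval[of b "z $ b" a] lower_bound_of_rank[of b] a that by simp
  ultimately have "z $ b = \<beta>"
    using linked_mono[OF _ sub_le_mono[of "z $ b" s]] s(1) by fastforce
  moreover have "\<not> linked E (sub_lt z \<gamma>) a b" unfolding sub_lt using b(2) linked_sym by metis
  ultimately show ?thesis using that a by blast
qed

lemma sublevel_rank_imp_two_wells:
  obtains a b where "two_wells E z a \<alpha> b \<beta> \<gamma>"
proof -
  obtain a b where ab: "z $ a = \<alpha>" "z $ b = \<beta>" "\<not> linked E (sub_lt z \<gamma>) a b"
    using separated_wells_of_rank .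
  have "linked E (sub_le z (z $ v)) v a \<or> linked E (sub_le z (z $ v)) v b" for v
  proof (cases "z $ v < \<beta> \<or> \<gamma> \<le> z $ v")
    case True
    then show ?thesis using linked_outside_merge_interval[of v "z $ v" a] ab(1) lower_bound_of_rank[of v]
      by simp
  next
    case False
    then have "sub_le z (z $ v) \<subseteq> sub_lt z \<gamma>" by (auto simp: sub_lt_def)
    then have "\<not> linked E (sub_le z (z $ v)) a b" using ab(3) linked_mono by metis
    moreover have "comp_count E (sub_le z (z $ v)) (sub_le z (z $ v)) = 2"
      using comp_count_of_rank[of "z $ v" "z $ v"] False order by simp
    ultimately show ?thesis
      using comp_count_2_linked[OF _ order_refl, of E "sub_le z (z $ v)" a b v] False ab(1,2) order by simp
  qed
  moreover have "linked E (sub_le z \<gamma>) a b" using linked_outside_merge_interval[of a \<gamma> b] ab(1,2) order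
    by simp
  ultimately show ?thesis using that[of a b] ab unfolding two_wells_def by blast
qed

end

theorem data_two_bars_iff:
  "z \<in> data E {#(\<alpha>, \<infinity>), (\<beta>, ereal \<gamma>)#} \<longleftrightarrow> (\<exists>a b. two_wells E z a \<alpha> b \<beta> \<gamma>)"
proof -
  have "bar_count {#(\<alpha>, \<infinity>), (\<beta>, ereal \<gamma>)#} r s = of_bool (\<alpha> \<le> r) + of_bool (\<beta> \<le> r \<and> s < \<gamma>)" for r s
    by (simp add: bar_count_def)
  moreover have "ereal b < d" if "(b,d) \<in># {#(\<alpha>, \<infinity>), (\<beta>, ereal \<gamma>)#}" for b d using that order by auto
  ultimately have "z \<in> data E {#(\<alpha>, \<infinity>), (\<beta>, ereal \<gamma>)#} \<longleftrightarrow>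
      (\<forall>r s. r \<le> s \<longrightarrow> sublevel_rank E z r s = of_bool (\<alpha> \<le> r) + of_bool (\<beta> \<le> r \<and> s < \<gamma>))"
    unfolding data_def mem_Collect_eq by (subst PH0_eq_iff_sublevel_rank) auto
  then show ?thesis
    using two_wells_imp_sublevel_rank sublevel_rank_imp_two_wells by (metis (no_types, lifting))
qed

end

section \<open>Trees\<close>

definition separators :: "'v set set \<Rightarrow> 'v \<Rightarrow> 'v \<Rightarrow> 'v set" where
  "separators E v w = {x. x = v \<or> x = w \<or> \<not> linked E (- {x}) v w}"

lemma separators_ends [simp]: "v \<in> separators E v w" "w \<in> separators E v w"
  by (simp_all add: separators_def)

lemma separators_refl [simp]: "separators E v v = {v}"
  by (auto simp: separators_def)

lemma separators_commute: "separators E v w = separators E w v"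
  using linked_sym unfolding separators_def by metis

lemma separators_triangle: "separators E v w \<subseteq> separators E v u \<union> separators E u w"
  using linked_trans unfolding separators_def by fast

lemma linked_imp_separators_subset:
  assumes "linked E S v w" "v \<in> S"
  shows "separators E v w \<subseteq> S"
proof
  fix x assume "x \<in> separators E v w"
  moreover have "linked E (- {x}) v w" if "x \<notin> S" using that by (intro linked_mono[OF assms(1)]) auto
  ultimately show "x \<in> S" using assms(2) linked_in[OF assms] by (auto simp: separators_def)
qed

lemma linked_separator:
  assumes "linked E S v w" "x \<in> separators E v w"
  shows "linked E S v x"
  using assms unfolding linked_def
proof (induction arbitrary: x rule: rtranclp_induct)
  case (step u w)
  have "x = w \<or> x \<in> separators E v u"
  proof (rule ccontr)
    assume "\<not> (x = w \<or> x \<in> separators E v u)"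
    then have x: "x \<noteq> v" "x \<noteq> w" and links: "linked E (- {x}) v u" "linked E (- {x}) u w"
      using step.hyps(2) by (auto simp: separators_def intro: linked_edge)
    have "linked E (- {x}) v w" using links by (rule linked_trans)
    then show False using step.prems x by (simp add: separators_def)
  qed
  then show ?case using step.IH rtranclp.rtrancl_into_rtrancl[OF step.hyps] by (elim disjE) simp_all
qed simp

locale tree =
  fixes E :: "'v::finite set set"
  assumes linked_separators: "linked E (separators E v w) v w"
begin

abbreviation tree_path :: "'v \<Rightarrow> 'v \<Rightarrow> 'v set" where "tree_path \<equiv> separators E"

lemma linked_iff: "v \<in> S \<Longrightarrow> linked E S v w \<longleftrightarrow> tree_path v w \<subseteq> S"
  using linked_imp_separators_subset linked_mono[OF linked_separators] by metis

lemma tree_path_subset: "x \<in> tree_path v w \<Longrightarrow> tree_path v x \<subseteq> tree_path v w"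
  using linked_separator[OF linked_separators] by (simp flip: linked_iff)

definition sides :: "'v \<Rightarrow> 'v set set" where
  "sides p = {{w. p \<notin> tree_path v w} | v. v \<noteq> p}"

lemma side_containing: "v \<noteq> p \<Longrightarrow> {w. p \<notin> tree_path v w} \<in> sides p"
  by (auto simp: sides_def)

lemma mem_side_iff:
  assumes "A \<in> sides p" "v \<in> A"
  shows "w \<in> A \<longleftrightarrow> p \<notin> tree_path v w"
proof -
  obtain u where u: "A = {w. p \<notin> tree_path u w}" using assms(1) by (auto simp: sides_def)
  then have "p \<notin> tree_path u v" "p \<notin> tree_path v u" using assms(2) separators_commute[of E u v] by auto
  then show ?thesis
    using separators_triangle[of E u w v] separators_triangle[of E v w u] unfolding u by blast
qed

lemma side_nonempty:
  assumes "A \<in> sides p"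
  shows "A \<noteq> {}"
proof -
  obtain v where "A = {w. p \<notin> tree_path v w}" "v \<noteq> p" using assms by (auto simp: sides_def)
  then have "v \<in> A" by simp
  then show ?thesis by blast
qed

lemma notin_side: "A \<in> sides p \<Longrightarrow> p \<notin> A"
  by (auto simp: sides_def)

lemma sides_disjoint: "A \<in> sides p \<Longrightarrow> B \<in> sides p \<Longrightarrow> A \<noteq> B \<Longrightarrow> A \<inter> B = {}"
  using mem_side_iff by blast

lemma sides_separated: "\<lbrakk>A \<in> sides p; B \<in> sides p; A \<noteq> B; v \<in> A; w \<in> B\<rbrakk> \<Longrightarrow> p \<in> tree_path v w"
  using mem_side_iff[of A p v w] sides_disjoint by blast

definition path_convex :: "'v set \<Rightarrow> bool" where
  "path_convex A \<longleftrightarrow> (\<forall>v\<in>A. \<forall>w\<in>A. tree_path v w \<subseteq> A)"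

lemma path_convex_side:
  assumes "A \<in> sides p"
  shows "path_convex A"
  unfolding path_convex_def
proof (intro ballI subsetI)
  fix v w x assume "v \<in> A" "w \<in> A" "x \<in> tree_path v w"
  then show "x \<in> A" using mem_side_iff[OF assms] tree_path_subset by blast
qed

section \<open>Convex cells\<close>

definition low :: "real^'v \<Rightarrow> 'v \<Rightarrow> 'v \<Rightarrow> bool" where
  "low z v w \<longleftrightarrow> (\<forall>x\<in>tree_path v w. z $ x \<le> z $ v)"

lemma linked_sub_le_iff_low: "linked E (sub_le z (z $ v)) v w \<longleftrightarrow> low z v w"
  by (subst linked_iff) (auto simp: low_def)

lemma two_wells_iff:
  assumes "\<alpha> < \<gamma>"
  shows "two_wells E z a \<alpha> b \<beta> \<gamma> \<longleftrightarrow> z $ a = \<alpha> \<and> z $ b = \<beta> \<and> (\<forall>x\<in>tree_path a b. z $ x \<le> \<gamma>) \<and>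
    (\<exists>p\<in>tree_path a b. z $ p = \<gamma>) \<and> (\<forall>v. low z v a \<or> low z v b)"
proof -
  have "linked E (sub_le z \<gamma>) a b \<and> \<not> linked E (sub_lt z \<gamma>) a b \<longleftrightarrow>
      (\<forall>x\<in>tree_path a b. z $ x \<le> \<gamma>) \<and> (\<exists>p\<in>tree_path a b. z $ p = \<gamma>)" if "z $ a = \<alpha>"
  proof -
    have "a \<in> sub_le z \<gamma>" "a \<in> sub_lt z \<gamma>" using that assms by (auto simp: sub_lt_def)
    then show ?thesis by (auto simp: linked_iff subset_iff sub_lt_def not_less intro: order_antisym)
  qed
  then show ?thesis unfolding two_wells_def linked_sub_le_iff_low by blast
qed

text \<open>Which of the two wells a vertex is monotone towards is decided by its position relative to the peak
  \<open>p\<close> rather than by \<open>z\<close>; this is what makes the cell convex.\<close>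

definition cell :: "real \<Rightarrow> 'v \<Rightarrow> 'v \<Rightarrow> real \<Rightarrow> 'v \<Rightarrow> real \<Rightarrow> (real^'v) set" where
  "cell \<gamma> p a \<alpha> b \<beta> = {z. z $ p = \<gamma> \<and> z $ a = \<alpha> \<and> z $ b = \<beta> \<and>
     (\<forall>v. (p \<in> tree_path v b \<longrightarrow> low z v a) \<and> (p \<in> tree_path v a \<longrightarrow> low z v b))}"

lemma cellD:
  assumes "z \<in> cell \<gamma> p a \<alpha> b \<beta>"
  shows "z $ p = \<gamma>" "z $ a = \<alpha>" "z $ b = \<beta>"
    "\<And>v x. \<lbrakk>p \<in> tree_path v b; x \<in> tree_path v a\<rbrakk> \<Longrightarrow> z $ x \<le> z $ v"
    "\<And>v x. \<lbrakk>p \<in> tree_path v a; x \<in> tree_path v b\<rbrakk> \<Longrightarrow> z $ x \<le> z $ v"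
  using assms by (auto simp: cell_def low_def)

lemma cell_commute: "cell \<gamma> p a \<alpha> b \<beta> = cell \<gamma> p b \<beta> a \<alpha>"
  by (auto simp: cell_def)

lemma cell_as_Inter:
  "cell \<gamma> p a \<alpha> b \<beta> = {z. z $ p = \<gamma>} \<inter> {z. z $ a = \<alpha>} \<inter> {z. z $ b = \<beta>} \<inter>
     (\<Inter>v\<in>{v. p \<in> tree_path v b}. \<Inter>x\<in>tree_path v a. {z. z $ x \<le> z $ v}) \<inter>
     (\<Inter>v\<in>{v. p \<in> tree_path v a}. \<Inter>x\<in>tree_path v b. {z. z $ x \<le> z $ v})"
  by (auto simp: cell_def low_def)

lemma convex_cell: "convex (cell \<gamma> p a \<alpha> b \<beta>)"
proof -
  have "convex {z :: real^'v. z $ x = r}" for x r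
    by (auto simp: convex_def simp flip: distrib_right)
  moreover have "convex {z :: real^'v. z $ x \<le> z $ v}" for x v
    by (auto simp: convex_def intro!: add_mono mult_left_mono)
  ultimately show ?thesis unfolding cell_as_Inter by (intro convex_Int convex_INT)
qed

lemma closed_cell: "closed (cell \<gamma> p a \<alpha> b \<beta>)"
proof -
  have "closed {z :: real^'v. z $ x = r}" for x r by (intro closed_Collect_eq continuous_intros)
  moreover have "closed {z :: real^'v. z $ x \<le> z $ v}" for x v
    by (intro closed_Collect_le continuous_intros)
  ultimately show ?thesis unfolding cell_as_Inter by (intro closed_Int closed_INT ballI)
qed

lemma low_beyond_peak:
  assumes "p \<in> tree_path v b" "z $ p = \<gamma>" "low z v b" "\<And>x. x \<in> tree_path a b \<Longrightarrow> z $ x \<le> \<gamma>"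
  shows "low z v a"
  unfolding low_def
proof
  fix x assume "x \<in> tree_path v a"
  then have "x \<in> tree_path v b \<or> x \<in> tree_path a b"
    using separators_triangle[of E v a b] separators_commute[of E a b] by blast
  moreover have "\<gamma> \<le> z $ v" using assms(1-3) by (auto simp: low_def)
  ultimately show "z $ x \<le> z $ v" using assms(3,4) by (fastforce simp: low_def)
qed

lemma cell_iff_two_wells:
  assumes p: "p \<in> tree_path a b" and "\<alpha> < \<gamma>"
  shows "z \<in> cell \<gamma> p a \<alpha> b \<beta> \<longleftrightarrow> z $ p = \<gamma> \<and> two_wells E z a \<alpha> b \<beta> \<gamma>"
proof
  assume z: "z \<in> cell \<gamma> p a \<alpha> b \<beta>"
  have "z $ x \<le> \<gamma>" if "x \<in> tree_path a b" for x
  proof -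
    have "x \<in> tree_path p a \<or> x \<in> tree_path p b"
      using that separators_triangle[of E a b p] separators_commute[of E a p] by auto
    then show ?thesis using cellD[OF z] separators_ends by metis
  qed
  moreover have "low z v a \<or> low z v b" for v
    using p separators_triangle[of E a b v] separators_commute[of E a v] z by (auto simp: cell_def)
  ultimately show "z $ p = \<gamma> \<and> two_wells E z a \<alpha> b \<beta> \<gamma>"
    using cellD(1-3)[OF z] p assms(2) by (auto simp: two_wells_iff)
next
  assume z: "z $ p = \<gamma> \<and> two_wells E z a \<alpha> b \<beta> \<gamma>"
  then have "low z v a \<or> low z v b" "\<And>x. x \<in> tree_path a b \<Longrightarrow> z $ x \<le> \<gamma>" for v
    using assms(2) by (auto simp: two_wells_iff)
  then have "(p \<in> tree_path v b \<longrightarrow> low z v a) \<and> (p \<in> tree_path v a \<longrightarrow> low z v b)" for v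
    using z low_beyond_peak[of p v b z \<gamma> a] low_beyond_peak[of p v a z \<gamma> b] separators_commute[of E a b]
    by blast
  then show "z \<in> cell \<gamma> p a \<alpha> b \<beta>" using z by (simp add: cell_def two_wells_def)
qed

lemma cell_slide_peak:
  assumes z: "z \<in> cell \<gamma> p a \<alpha> b \<beta>" and p: "p \<in> tree_path a b" and q: "q \<in> tree_path a b"
    and "p \<in> tree_path q b" "p' \<in> tree_path q a" "z $ p' = \<gamma>" "\<alpha> < \<gamma>"
  shows "z \<in> cell \<gamma> q a \<alpha> b \<beta>"
proof -
  have "two_wells E z a \<alpha> b \<beta> \<gamma>" using z cell_iff_two_wells[OF p] assms(7) by blast
  moreover have "z $ q = \<gamma>"
  proof (rule order_antisym)
    show "z $ q \<le> \<gamma>" using calculation q assms(7) by (simp add: two_wells_iff)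
    show "\<gamma> \<le> z $ q" using cellD(4)[OF z] assms(4-6) by blast
  qed
  ultimately show ?thesis using cell_iff_two_wells[OF q] assms(7) by blast
qed

definition cells :: "real \<Rightarrow> 'v \<Rightarrow> 'v set \<Rightarrow> real \<Rightarrow> 'v set \<Rightarrow> real \<Rightarrow> (real^'v) set" where
  "cells \<gamma> p A \<alpha> B \<beta> = (\<Union>a\<in>A. \<Union>b\<in>B. cell \<gamma> p a \<alpha> b \<beta>)"

lemma mem_cells_iff: "z \<in> cells \<gamma> p A \<alpha> B \<beta> \<longleftrightarrow> (\<exists>a\<in>A. \<exists>b\<in>B. z \<in> cell \<gamma> p a \<alpha> b \<beta>)"
  by (simp add: cells_def)

lemma cells_commute: "cells \<gamma> p A \<alpha> B \<beta> = cells \<gamma> p B \<beta> A \<alpha>"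
  unfolding cells_def cell_commute[of \<gamma> p _ \<alpha>] by (rule SUP_commute)

lemma closed_cells: "closed (cells \<gamma> p A \<alpha> B \<beta>)"
  unfolding cells_def by (intro closed_UN finite ballI closed_cell)

lemma cell_common_point:
  assumes "path_convex A" "path_convex B" "A \<inter> B = {}" "p \<notin> A" "p \<notin> B" "a \<in> A" "b \<in> B" "\<alpha> \<le> \<gamma>" "\<beta> \<le> \<gamma>"
  shows "(\<chi> v. if v \<in> A then \<alpha> else if v \<in> B then \<beta> else \<gamma>) \<in> cell \<gamma> p a \<alpha> b \<beta>"
proof -
  let ?z = "(\<chi> v. if v \<in> A then \<alpha> else if v \<in> B then \<beta> else \<gamma>) :: real^'v"
  have A: "x \<in> A" if "v \<in> A" "x \<in> tree_path v a" for v x using assms(1,6) that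
    by (auto simp: path_convex_def)
  have B: "x \<in> B" if "v \<in> B" "x \<in> tree_path v b" for v x using assms(2,7) that
    by (auto simp: path_convex_def)
  have "low ?z v a" if "p \<in> tree_path v b" for v
  proof -
    have "v \<notin> B" using B that assms(5) by blast
    then show ?thesis using A assms(8,9) by (cases "v \<in> A") (auto simp: low_def)
  qed
  moreover have "low ?z v b" if "p \<in> tree_path v a" for v
  proof -
    have "v \<notin> A" using A that assms(4) by blast
    then show ?thesis using B assms(3,8,9) by (cases "v \<in> B") (fastforce simp: low_def)+
  qed
  ultimately show ?thesis using assms by (auto simp: cell_def)
qed

lemma cell_wells_on_same_sides:
  assumes z: "z \<in> cell \<gamma> p a \<alpha> b \<beta>" "z \<in> cell \<gamma> p' a' \<alpha> b' \<beta>"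
    and p': "p' \<in> tree_path a' b'" and levels: "\<alpha> \<noteq> \<beta>" "\<alpha> < \<gamma>" "\<beta> < \<gamma>"
  shows "p \<notin> tree_path a' a \<and> p \<notin> tree_path b' b"
proof -
  have lower: "q \<notin> tree_path c' c"
    if "z \<in> cell \<gamma> q c \<delta> d \<epsilon>" "z $ c' = \<delta>" "\<delta> < \<epsilon>" for q c d c' \<delta> \<epsilon>
    using cellD(5)[OF that(1), of c' d] cellD(3)[OF that(1)] that(2,3) by force
  have upper: "q \<notin> tree_path d' d"
    if zq: "z \<in> cell \<gamma> q c \<delta> d \<epsilon>" and zq': "z \<in> cell \<gamma> q' c' \<delta> d' \<epsilon>"
      and q': "q' \<in> tree_path c' d'" and "\<delta> < \<epsilon>" "\<epsilon> < \<gamma>" for q c d q' c' d' \<delta> \<epsilon>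
  proof
    assume "q \<in> tree_path d' d"
    then have below_well: "z $ x \<le> \<epsilon>" if "x \<in> tree_path d' c" for x
      using cellD(4)[OF zq] cellD(3)[OF zq'] that by metis
    have "q' \<notin> tree_path c c'" using lower[OF zq' cellD(2)[OF zq] \<open>\<delta> < \<epsilon>\<close>] .
    then have "q' \<in> tree_path d' c"
      using q' separators_triangle[of E c' d' c] separators_commute[of E c' c] separators_commute[of E c d']
      by auto
    then show False using below_well cellD(1)[OF zq'] \<open>\<epsilon> < \<gamma>\<close> by force
  qed
  show ?thesis
  proof (cases "\<alpha> < \<beta>")
    case True
    then show ?thesis using lower[OF z(1) cellD(2)[OF z(2)]] upper[OF z p'] levels by blast
  next
    case False
    moreover have "z \<in> cell \<gamma> p b \<beta> a \<alpha>" "z \<in> cell \<gamma> p' b' \<beta> a' \<alpha>" "p' \<in> tree_path b' a'"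
      using z p' cell_commute separators_commute by metis+
    ultimately show ?thesis
      using lower[of p b \<beta> a \<alpha> b'] upper[of p b \<beta> a \<alpha> p' b' a'] cellD(3)[OF z(2)] levels by force
  qed
qed

lemma cells_meet:
  assumes z: "z \<in> cell \<gamma> p a \<alpha> b \<beta>" "z \<in> cell \<gamma> p' a' \<alpha> b' \<beta>"
    and sides: "A \<in> sides p" "B \<in> sides p" "A \<noteq> B" "A' \<in> sides p'" "B' \<in> sides p'" "A' \<noteq> B'"
    and wells: "a \<in> A" "b \<in> B" "a' \<in> A'" "b' \<in> B'"
    and levels: "\<alpha> \<noteq> \<beta>" "\<alpha> < \<gamma>" "\<beta> < \<gamma>"
  shows "a \<in> A' \<and> a' \<in> A \<and> b \<in> B' \<and> b' \<in> B"
proof -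
  have "p \<in> tree_path a b" "p' \<in> tree_path a' b'" using sides_separated sides wells by metis+
  then have "p \<notin> tree_path a' a \<and> p \<notin> tree_path b' b" "p' \<notin> tree_path a a' \<and> p' \<notin> tree_path b b'"
    using cell_wells_on_same_sides[OF z] cell_wells_on_same_sides[OF z(2,1)] levels by blast+
  then show ?thesis
    using mem_side_iff sides wells separators_commute[of E a a'] separators_commute[of E b b'] by metis
qed

lemma cells_Int_nonempty:
  assumes "z \<in> cells \<gamma> p A \<alpha> B \<beta>" "z \<in> cells \<gamma> p' A' \<alpha> B' \<beta>"
    and "A \<in> sides p" "B \<in> sides p" "A \<noteq> B" "A' \<in> sides p'" "B' \<in> sides p'" "A' \<noteq> B'"
    and "\<alpha> \<noteq> \<beta>" "\<alpha> < \<gamma>" "\<beta> < \<gamma>"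
  shows "A \<inter> A' \<noteq> {} \<and> B \<inter> B' \<noteq> {}"
proof -
  obtain a b a' b' where "a \<in> A" "b \<in> B" "a' \<in> A'" "b' \<in> B'"
    "z \<in> cell \<gamma> p a \<alpha> b \<beta>" "z \<in> cell \<gamma> p' a' \<alpha> b' \<beta>" using assms(1,2) unfolding mem_cells_iff by blast
  then show ?thesis using cells_meet[OF _ _ assms(3-8)] assms(9-11) by blast
qed

lemma AR_cells_Int:
  assumes sides: "A \<in> sides p" "B \<in> sides p" "A \<noteq> B" "A' \<in> sides p'" "B' \<in> sides p'" "A' \<noteq> B'"
    and nested: "A' \<subseteq> A" "B \<subseteq> B'"
    and levels: "\<alpha> \<noteq> \<beta>" "\<alpha> < \<gamma>" "\<beta> < \<gamma>"
  shows "AR (cells \<gamma> p A \<alpha> B \<beta> \<inter> cells \<gamma> p' A' \<alpha> B' \<beta>)"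
proof -
  define C where "C = (\<lambda>(a,b,a',b'). cell \<gamma> p a \<alpha> b \<beta> \<inter> cell \<gamma> p' a' \<alpha> b' \<beta>)"
  have "z \<in> (\<Union>w\<in>A' \<times> B \<times> A' \<times> B. C w) \<longleftrightarrow> z \<in> cells \<gamma> p A \<alpha> B \<beta> \<inter> cells \<gamma> p' A' \<alpha> B' \<beta>" for z
  proof
    assume "z \<in> cells \<gamma> p A \<alpha> B \<beta> \<inter> cells \<gamma> p' A' \<alpha> B' \<beta>"
    then obtain a b a' b' where wells: "a \<in> A" "b \<in> B" "a' \<in> A'" "b' \<in> B'"
      "z \<in> cell \<gamma> p a \<alpha> b \<beta>" "z \<in> cell \<gamma> p' a' \<alpha> b' \<beta>" by (auto simp: mem_cells_iff)
    then have "a \<in> A'" "b' \<in> B" using cells_meet[OF wells(5,6) sides wells(1-4) levels] by auto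
    then show "z \<in> (\<Union>w\<in>A' \<times> B \<times> A' \<times> B. C w)"
      using wells by (intro UN_I[of "(a,b,a',b')"]) (auto simp: C_def)
  next
    assume "z \<in> (\<Union>w\<in>A' \<times> B \<times> A' \<times> B. C w)"
    then show "z \<in> cells \<gamma> p A \<alpha> B \<beta> \<inter> cells \<gamma> p' A' \<alpha> B' \<beta>"
      using nested unfolding C_def by (auto simp: mem_cells_iff)
  qed
  then have "(\<Union>w\<in>A' \<times> B \<times> A' \<times> B. C w) = cells \<gamma> p A \<alpha> B \<beta> \<inter> cells \<gamma> p' A' \<alpha> B' \<beta>" by blast
  moreover have "AR (\<Union>w\<in>A' \<times> B \<times> A' \<times> B. C w)"
  proof (rule AR_UN_convex_common_point)
    have "A' \<inter> B = {}" "p \<notin> A'" "p \<notin> B" "p' \<notin> A'" "p' \<notin> B"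
      using sides_disjoint[OF sides(1-3)] notin_side sides nested by blast+
    then show "(\<chi> v. if v \<in> A' then \<alpha> else if v \<in> B then \<beta> else \<gamma>) \<in> C w" if "w \<in> A' \<times> B \<times> A' \<times> B" for w
      using that levels path_convex_side sides(2,4) by (auto simp: C_def intro!: cell_common_point)
  qed (use side_nonempty[OF sides(2)] side_nonempty[OF sides(4)] in
      \<open>auto simp: C_def closed_cell convex_cell intro!: closed_Int convex_Int\<close>)
  ultimately show ?thesis by simp
qed

lemma AR_cells:
  assumes "A \<in> sides p" "B \<in> sides p" "A \<noteq> B" "\<alpha> \<noteq> \<beta>" "\<alpha> < \<gamma>" "\<beta> < \<gamma>"
  shows "AR (cells \<gamma> p A \<alpha> B \<beta>)"
  using AR_cells_Int[of A p B A p B \<alpha> \<beta> \<gamma>] assms by simp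

theorem data_iff_cells:
  assumes "\<alpha> < \<beta>" "\<beta> < \<gamma>"
  shows "z \<in> data E {#(\<alpha>, \<infinity>), (\<beta>, ereal \<gamma>)#} \<longleftrightarrow>
    (\<exists>p. \<exists>A\<in>sides p. \<exists>B\<in>sides p. A \<noteq> B \<and> z \<in> cells \<gamma> p A \<alpha> B \<beta>)"
proof
  assume "z \<in> data E {#(\<alpha>, \<infinity>), (\<beta>, ereal \<gamma>)#}"
  then obtain a b where wells: "two_wells E z a \<alpha> b \<beta> \<gamma>" using data_two_bars_iff[OF assms] by blast
  then obtain p where p: "p \<in> tree_path a b" "z $ p = \<gamma>" "z $ a = \<alpha>" "z $ b = \<beta>"
    using assms by (auto simp: two_wells_iff)
  then have "p \<noteq> a" "p \<noteq> b" using assms by auto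
  define A where "A = {w. p \<notin> tree_path a w}"
  define B where "B = {w. p \<notin> tree_path b w}"
  have sides: "A \<in> sides p" "B \<in> sides p" "a \<in> A" "b \<in> B" "b \<notin> A"
    using \<open>p \<noteq> a\<close> \<open>p \<noteq> b\<close> p(1) by (auto simp: A_def B_def side_containing)
  have "z \<in> cell \<gamma> p a \<alpha> b \<beta>" using cell_iff_two_wells[OF p(1)] wells p(2) assms by simp
  then have "z \<in> cells \<gamma> p A \<alpha> B \<beta>" using sides unfolding mem_cells_iff by blast
  then show "\<exists>p. \<exists>A\<in>sides p. \<exists>B\<in>sides p. A \<noteq> B \<and> z \<in> cells \<gamma> p A \<alpha> B \<beta>" using sides by blast
next
  assume "\<exists>p. \<exists>A\<in>sides p. \<exists>B\<in>sides p. A \<noteq> B \<and> z \<in> cells \<gamma> p A \<alpha> B \<beta>"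
  then obtain p a b where "p \<in> tree_path a b" "z \<in> cell \<gamma> p a \<alpha> b \<beta>"
    using sides_separated unfolding mem_cells_iff by metis
  then show "z \<in> data E {#(\<alpha>, \<infinity>), (\<beta>, ereal \<gamma>)#}"
    using cell_iff_two_wells data_two_bars_iff[OF assms] assms by force
qed

end

section \<open>Star-like trees\<close>

locale star_tree =
  fixes E :: "'v::finite set set" and n :: nat and c :: 'v
    and node :: "nat \<Rightarrow> nat \<Rightarrow> 'v" and height :: "nat \<Rightarrow> nat"
  assumes node_0: "i < n \<Longrightarrow> node i 0 = c"
    and node_eq_iff: "\<lbrakk>i < n; j < n; k \<le> height i; l \<le> height j\<rbrakk> \<Longrightarrow>
          node i k = node j l \<longleftrightarrow> k = l \<and> (k = 0 \<or> i = j)"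
    and node_surj: "\<exists>i<n. \<exists>k\<le>height i. v = node i k"
    and height_ge_2: "i < n \<Longrightarrow> 2 \<le> height i"
    and E_eq: "E = {{node i k, node i (Suc k)} | i k. i < n \<and> k < height i}"

lemma nth_eq_nth_iff_meet_in_head:
  assumes "distinct xs" "distinct ys" "k < length xs" "l < length ys"
    and "xs ! 0 = x" "ys ! 0 = x" "set xs \<inter> set ys = {x}"
  shows "xs ! k = ys ! l \<longleftrightarrow> k = 0 \<and> l = 0"
proof
  assume meet: "xs ! k = ys ! l"
  then have "xs ! k \<in> set xs \<inter> set ys" using nth_mem[OF assms(3)] nth_mem[OF assms(4)] by simp
  then have "xs ! k = xs ! 0" "ys ! l = ys ! 0" using assms(5-7) meet by simp_all
  moreover have "0 < length xs" "0 < length ys" using assms(3,4) by linarith+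
  ultimately show "k = 0 \<and> l = 0"
    using nth_eq_iff_index_eq[OF assms(1,3)] nth_eq_iff_index_eq[OF assms(2,4)] by blast
qed (use assms(5,6) in simp)

lemma star_like_tree_imp_star_tree:
  fixes E :: "'v::finite set set"
  assumes "star_like_tree E n"
  obtains c node height where "star_tree E n c node height"
proof -
  obtain c ps where len: "length ps = n"
    and ps: "\<forall>p\<in>set ps. distinct p \<and> length p \<ge> 3 \<and> hd p = c"
    and meet: "\<forall>i<n. \<forall>j<n. i \<noteq> j \<longrightarrow> set (ps!i) \<inter> set (ps!j) = {c}"
    and cover: "(\<Union>p\<in>set ps. set p) = UNIV"
    and E: "E = (\<Union>p\<in>set ps. {{p!k, p!(k+1)} | k. k + 1 < length p})"
    using assms unfolding star_like_tree_def by blast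
  have set_ps: "set ps = (!) ps ` {..<n}" using len by (auto simp: set_conv_nth)
  have branch: "distinct (ps!i)" "length (ps!i) \<ge> 3" "ps!i!0 = c" if "i < n" for i
    using ps that len hd_conv_nth[of "ps!i"] nth_mem[of i ps] by fastforce+
  define height where "height i = length (ps!i) - 1" for i
  have le_height: "k \<le> height i \<longleftrightarrow> k < length (ps!i)" if "i < n" for i k
    using branch(2)[OF that] by (auto simp: height_def)
  have "star_tree E n c (\<lambda>i k. ps!i!k) height"
  proof
    show "ps!i!k = ps!j!l \<longleftrightarrow> k = l \<and> (k = 0 \<or> i = j)"
      if "i < n" "j < n" "k \<le> height i" "l \<le> height j" for i j k l
    proof (cases "i = j")
      case True
      then show ?thesis using that branch(1) le_height by (simp add: nth_eq_iff_index_eq)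
    next
      case False
      then have "set (ps!i) \<inter> set (ps!j) = {c}" using meet that(1,2) by blast
      then show ?thesis
        using nth_eq_nth_iff_meet_in_head[OF branch(1)[OF that(1)] branch(1)[OF that(2)]]
          branch(3) that le_height False
        by auto
    qed
    show "\<exists>i<n. \<exists>k\<le>height i. v = ps!i!k" for v
    proof -
      obtain i where "i < n" "v \<in> set (ps!i)" using cover unfolding set_ps by blast
      then show ?thesis using le_height by (metis in_set_conv_nth)
    qed
    have "k < height i \<longleftrightarrow> k + 1 < length (ps!i)" for i k by (auto simp: height_def)
    then show "E = {{ps!i!k, ps!i!Suc k} | i k. i < n \<and> k < height i}"
      unfolding E set_ps by auto
    show "2 \<le> height i" if "i < n" for i using branch(2)[OF that] by (simp add: height_def)
  qed (rule branch(3))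
  then show ?thesis by (rule that)
qed

context star_tree begin

definition outward :: "nat \<Rightarrow> nat \<Rightarrow> 'v set" where
  "outward i m = node i ` {m<..height i}"

lemma node_in_outward_iff:
  "\<lbrakk>i < n; j < n; k \<le> height j\<rbrakk> \<Longrightarrow> node j k \<in> outward i m \<longleftrightarrow> j = i \<and> m < k"
  by (auto simp: outward_def node_eq_iff)

lemma vertex_cases:
  obtains i k where "i < n" "k \<le> height i" "v = node i k"
  using node_surj[of v] by blast

lemma edge_nodes: "\<lbrakk>i < n; k < height i\<rbrakk> \<Longrightarrow> {node i k, node i (Suc k)} \<in> E"
  unfolding E_eq by blast

lemma edge_leaving_outward:
  assumes "{u,w} \<in> E" "u \<in> outward i m" "w \<notin> outward i m" "i < n"
  shows "w = node i m"
proof -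
  obtain j k where jk: "j < n" "k < height j" "{u,w} = {node j k, node j (Suc k)}"
    using assms(1) unfolding E_eq by blast
  then consider "u = node j k" "w = node j (Suc k)" | "u = node j (Suc k)" "w = node j k"
    by (auto simp: doubleton_eq_iff)
  then show ?thesis
    using assms(2-4) jk(1,2) by cases (auto simp: node_in_outward_iff less_Suc_eq)
qed

lemma node_separates:
  assumes "v \<in> outward i m" "w \<notin> outward i m" "i < n"
  shows "node i m \<in> separators E v w"
proof -
  have "\<not> linked E (- {node i m}) v w"
  proof
    assume "linked E (- {node i m}) v w"
    then obtain u u' where "u \<in> outward i m" "u' \<notin> outward i m" "u' \<noteq> node i m" "{u,u'} \<in> E"
      using rtranclp_leaves_set[OF _ assms(1,2)] unfolding linked_def by blast
    then show False using edge_leaving_outward assms(3) by blast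
  qed
  then show ?thesis by (simp add: separators_def)
qed

lemma linked_nodes:
  assumes "i < n" "k \<le> l" "l \<le> height i"
  shows "linked E (node i ` {k..l}) (node i k) (node i l)"
  using assms(2,3)
proof (induction l rule: dec_induct)
  case (step l)
  then have "linked E (node i ` {k..Suc l}) (node i k) (node i l)" by (auto intro: linked_mono)
  moreover have "linked E (node i ` {k..Suc l}) (node i l) (node i (Suc l))"
    using step edge_nodes[OF assms(1), of l] by (intro linked_edge) auto
  ultimately show ?case by (rule linked_trans)
qed simp

lemma linked_nodes_branches:
  assumes "i < n" "j < n" "k \<le> height i" "l \<le> height j"
  shows "linked E (node i ` {0..k} \<union> node j ` {0..l}) (node i k) (node j l)"
proof -
  have "linked E (node i ` {0..k} \<union> node j ` {0..l}) (node i k) c"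
    using linked_nodes[of i 0 k] assms node_0 by (auto intro: linked_sym linked_mono)
  moreover have "linked E (node i ` {0..k} \<union> node j ` {0..l}) c (node j l)"
    using linked_nodes[of j 0 l] assms node_0 by (auto intro: linked_mono)
  ultimately show ?thesis by (rule linked_trans)
qed

lemma segment_subset_separators:
  assumes "i < n" "k \<le> l" "l \<le> height i"
  shows "node i ` {k..l} \<subseteq> separators E (node i k) (node i l)"
proof clarify
  fix x assume x: "x \<in> {k..l}"
  show "node i x \<in> separators E (node i k) (node i l)"
  proof (cases "x = l")
    case False
    then have "node i l \<in> outward i x" "node i k \<notin> outward i x" using x assms
      by (auto simp: node_in_outward_iff)
    then have "node i x \<in> separators E (node i l) (node i k)" by (rule node_separates[OF _ _ assms(1)])
    then show ?thesis using separators_commute by metis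
  qed simp
qed

lemma segments_subset_separators:
  assumes "i < n" "j < n" "i \<noteq> j" "k \<le> height i" "l \<le> height j"
  shows "node i ` {0..k} \<union> node j ` {0..l} \<subseteq> separators E (node i k) (node j l)"
proof -
  have "node i ` {0..k} \<subseteq> separators E (node i k) (node j l)"
    if "i < n" "j < n" "i \<noteq> j" "k \<le> height i" "l \<le> height j" for i j k l
  proof clarify
    fix x assume x: "x \<in> {0..k}"
    show "node i x \<in> separators E (node i k) (node j l)"
    proof (cases "x = k")
      case False
      then have "node i k \<in> outward i x" "node j l \<notin> outward i x" using x that
        by (auto simp: node_in_outward_iff)
      then show ?thesis by (rule node_separates[OF _ _ that(1)])
    qed simp
  qed
  from this[of i j k l] this[of j i l k] show ?thesis
    using assms separators_commute[of E "node i k" "node j l"] by auto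
qed

end

sublocale star_tree \<subseteq> tree E
proof
  fix v w
  obtain i k where v: "i < n" "k \<le> height i" "v = node i k" by (rule vertex_cases)
  obtain j l where w: "j < n" "l \<le> height j" "w = node j l" by (rule vertex_cases)
  show "linked E (separators E v w) v w"
  proof (cases "i = j")
    case True
    have "linked E (separators E (node i k) (node i l)) (node i k) (node i l)"
      if "k \<le> l" "l \<le> height i" for k l
      using linked_mono linked_nodes segment_subset_separators v(1) that by metis
    then show ?thesis
      using True v w linked_sym separators_commute by (metis nat_le_linear)
  next
    case False
    then show ?thesis
      using linked_mono[OF linked_nodes_branches segments_subset_separators] v w by blast
  qed
qed

context star_tree begin

lemma tree_path_same_branch:
  assumes "i < n" "k \<le> l" "l \<le> height i"
  shows "tree_path (node i k) (node i l) = node i ` {k..l}"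
proof
  show "tree_path (node i k) (node i l) \<subseteq> node i ` {k..l}"
    using assms(2) by (intro linked_imp_separators_subset[OF linked_nodes[OF assms]]) simp
qed (rule segment_subset_separators[OF assms])

lemma centre_notin_outward: "i < n \<Longrightarrow> c \<notin> outward i m"
  using node_in_outward_iff[of i i 0 m] node_0 by auto

lemma outward_disjoint: "\<lbrakk>i < n; j < n; i \<noteq> j\<rbrakk> \<Longrightarrow> outward i m \<inter> outward j m' = {}"
  by (auto simp: outward_def node_eq_iff)

lemma outward_mono: "m \<le> m' \<Longrightarrow> outward i m' \<subseteq> outward i m"
  by (auto simp: outward_def)

definition inward :: "nat \<Rightarrow> nat \<Rightarrow> 'v set" where
  "inward i m = {w. node i m \<notin> tree_path c w}"

lemma node_in_inward_iff:
  assumes "i < n" "j < n" "k \<le> height j" "m \<le> height i" "1 \<le> m"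
  shows "node j k \<in> inward i m \<longleftrightarrow> \<not> (j = i \<and> m \<le> k)"
  using tree_path_same_branch[of j 0 k] node_0 assms by (auto simp: inward_def node_eq_iff image_iff)

lemma outward_side:
  assumes "i < n" "m < height i"
  shows "outward i m \<in> sides (node i m)"
proof -
  let ?v = "node i (Suc m)"
  have v: "?v \<in> outward i m" using assms by (simp add: node_in_outward_iff)
  have "node i m \<notin> tree_path ?v w" if "w \<in> outward i m" for w
  proof -
    obtain l where "w = node i l" "Suc m \<le> l" "l \<le> height i" using \<open>w \<in> outward i m\<close>
      by (auto simp: outward_def)
    then show ?thesis using assms by (auto simp: tree_path_same_branch node_eq_iff)
  qed
  then have "outward i m = {w. node i m \<notin> tree_path ?v w}" using node_separates[OF v] assms(1) by auto
  moreover have "?v \<noteq> node i m" using assms by (simp add: node_eq_iff)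
  ultimately show ?thesis using side_containing by metis
qed

lemma inward_side:
  assumes "i < n" "1 \<le> m" "m \<le> height i"
  shows "inward i m \<in> sides (node i m)"
  unfolding inward_def using side_containing node_eq_iff[of i i 0 m] node_0[of i] assms by auto

lemma outward_inward_cases:
  assumes "i < n" "1 \<le> m" "m \<le> height i" "v \<noteq> node i m"
  shows "v \<in> outward i m \<or> v \<in> inward i m"
proof -
  obtain j k where "j < n" "k \<le> height j" "v = node j k" by (rule vertex_cases)
  then show ?thesis using assms by (auto simp: node_in_outward_iff node_in_inward_iff)
qed

lemma outward_Int_inward: "\<lbrakk>i < n; 1 \<le> m; m \<le> height i\<rbrakk> \<Longrightarrow> outward i m \<inter> inward i m = {}"
  by (auto simp: outward_def node_in_inward_iff)

lemma outward_neq_inward: "\<lbrakk>i < n; 1 \<le> m; m < height i\<rbrakk> \<Longrightarrow> outward i m \<noteq> inward i m"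
  using outward_Int_inward[of i m] side_nonempty[OF outward_side[of i m]] by auto

lemma outward_Int_inward_less:
  assumes "v \<in> outward i m" "v \<in> inward i m'" "i < n" "1 \<le> m'" "m' \<le> height i"
  shows "m < m'"
  using assms by (auto simp: outward_def node_in_inward_iff)

lemma inward_mono:
  assumes "i < n" "1 \<le> m" "m \<le> m'" "m' \<le> height i"
  shows "inward i m \<subseteq> inward i m'"
proof
  fix v assume "v \<in> inward i m"
  moreover obtain j k where "j < n" "k \<le> height j" "v = node j k" by (rule vertex_cases)
  ultimately show "v \<in> inward i m'" using assms by (auto simp: node_in_inward_iff)
qed

lemma outward_subset_inward:
  assumes "i < n" "j < n" "i \<noteq> j" "1 \<le> m" "m \<le> height i"
  shows "outward j k \<subseteq> inward i m"
  using assms by (auto simp: outward_def node_in_inward_iff)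

lemma sides_node_cases:
  assumes "i < n" "1 \<le> m" "m \<le> height i" "A \<in> sides (node i m)" "B \<in> sides (node i m)" "A \<noteq> B"
  shows "m < height i \<and> (A = outward i m \<and> B = inward i m \<or> A = inward i m \<and> B = outward i m)"
proof -
  have side: "m < height i \<and> D = outward i m \<or> D = inward i m" if "D \<in> sides (node i m)" for D
  proof -
    obtain v where v: "v \<in> D" using side_nonempty[OF \<open>D \<in> sides (node i m)\<close>] by blast
    then have "v \<in> outward i m \<or> v \<in> inward i m"
      using outward_inward_cases[OF assms(1-3)] notin_side[OF that] by metis
    moreover have "m < height i" if "v \<in> outward i m" using that by (auto simp: outward_def)
    ultimately show ?thesis
      using v sides_disjoint[OF that outward_side[OF assms(1)]]
        sides_disjoint[OF that inward_side[OF assms(1-3)]]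
      by blast
  qed
  show ?thesis using side[OF assms(4)] side[OF assms(5)] assms(6) by blast
qed

lemma outward_side_centre: "i < n \<Longrightarrow> outward i 0 \<in> sides c"
  using outward_side[of i 0] height_ge_2[of i] node_0[of i] by simp

lemma sides_centre_cases:
  assumes "A \<in> sides c"
  obtains i where "i < n" "A = outward i 0"
proof -
  obtain v where v: "v \<in> A" using side_nonempty[OF assms] by blast
  obtain i k where ik: "i < n" "k \<le> height i" "v = node i k" by (rule vertex_cases)
  have "k \<noteq> 0"
  proof
    assume "k = 0"
    then have "v = c" using ik node_0 by simp
    then show False using v notin_side[OF assms] by simp
  qed
  then have "v \<in> outward i 0" using ik by (simp add: node_in_outward_iff)
  then show ?thesis using that[OF ik(1)] sides_disjoint[OF assms outward_side_centre[OF ik(1)]] v by blast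
qed

lemma outward_neq: "\<lbrakk>i < n; j < n; i \<noteq> j\<rbrakk> \<Longrightarrow> outward i 0 \<noteq> outward j 0"
  using outward_disjoint[of i j 0 0] side_nonempty[OF outward_side_centre[of i]] by auto

section \<open>The cover of the space of vectors with two bars\<close>

definition level :: "real \<Rightarrow> nat \<Rightarrow> real \<Rightarrow> real \<Rightarrow> nat \<Rightarrow> (real^'v) set" where
  "level \<gamma> i \<alpha> \<beta> m = cells \<gamma> (node i m) (outward i m) \<alpha> (inward i m) \<beta>"

definition tower :: "real \<Rightarrow> nat \<Rightarrow> real \<Rightarrow> real \<Rightarrow> (real^'v) set" where
  "tower \<gamma> i \<alpha> \<beta> = (\<Union>m\<in>{1..<height i}. level \<gamma> i \<alpha> \<beta> m)"

definition saddle :: "real \<Rightarrow> nat \<Rightarrow> real \<Rightarrow> nat \<Rightarrow> real \<Rightarrow> (real^'v) set" where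
  "saddle \<gamma> i \<alpha> j \<beta> = cells \<gamma> c (outward i 0) \<alpha> (outward j 0) \<beta>"

lemma saddle_commute: "saddle \<gamma> i \<alpha> j \<beta> = saddle \<gamma> j \<beta> i \<alpha>"
  unfolding saddle_def by (rule cells_commute)

lemma closed_saddle: "closed (saddle \<gamma> i \<alpha> j \<beta>)"
  unfolding saddle_def by (rule closed_cells)

lemma closed_tower: "closed (tower \<gamma> i \<alpha> \<beta>)"
  unfolding tower_def level_def by (intro closed_UN ballI closed_cells) simp

definition saddled_tower :: "real \<Rightarrow> nat \<Rightarrow> real \<Rightarrow> real \<Rightarrow> (real^'v) set" where
  "saddled_tower \<gamma> i \<alpha> \<beta> = tower \<gamma> i \<alpha> \<beta> \<union> (\<Union>j\<in>{..<n} - {i}. saddle \<gamma> i \<alpha> j \<beta>)"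

lemma closed_saddled_tower: "closed (saddled_tower \<gamma> i \<alpha> \<beta>)"
  unfolding saddled_tower_def by (intro closed_Un closed_tower closed_UN ballI closed_saddle) simp

lemma mem_tower_iff:
  "z \<in> tower \<gamma> i \<alpha> \<beta> \<longleftrightarrow> (\<exists>m\<in>{1..<height i}. z \<in> cells \<gamma> (node i m) (outward i m) \<alpha> (inward i m) \<beta>)"
  by (simp add: tower_def level_def)

lemma saddled_towerE:
  assumes "z \<in> saddled_tower \<gamma> i \<alpha> \<beta>" "i < n"
  obtains p A B where "A \<in> sides p" "B \<in> sides p" "A \<noteq> B" "z \<in> cells \<gamma> p A \<alpha> B \<beta>" "A \<subseteq> outward i 0"
proof (cases "z \<in> tower \<gamma> i \<alpha> \<beta>")
  case True
  then obtain m where "1 \<le> m" "m < height i" "z \<in> cells \<gamma> (node i m) (outward i m) \<alpha> (inward i m) \<beta>"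
    by (auto simp: mem_tower_iff)
  then show ?thesis
    using that[of "outward i m" "node i m" "inward i m"] outward_side inward_side
      outward_neq_inward outward_mono assms(2)
    by simp
next
  case False
  then obtain j where "j < n" "i \<noteq> j" "z \<in> saddle \<gamma> i \<alpha> j \<beta>" using assms(1)
    by (auto simp: saddled_tower_def)
  then show ?thesis
    using that[of "outward i 0" c "outward j 0"] outward_side_centre outward_neq assms(2)
    by (simp add: saddle_def)
qed

context
  fixes \<alpha> \<beta> \<gamma> :: real
  assumes levels: "\<alpha> \<noteq> \<beta>" "\<alpha> < \<gamma>" "\<beta> < \<gamma>"
begin

text \<open>If the peak may sit at depth \<open>l\<close> and at depth \<open>m'\<close>, then \<open>z\<close> is constant between them, so the peak
  may sit at every depth in between.\<close>

lemma mem_level_between: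
  assumes i: "i < n" and lm: "l \<le> m" "1 \<le> m" "m \<le> m'" "m' < height i"
    and B: "B \<in> sides (node i l)" "B \<noteq> outward i l"
    and z: "z \<in> cells \<gamma> (node i l) (outward i l) \<alpha> B \<beta>" "z \<in> level \<gamma> i \<alpha> \<beta> m'"
  shows "z \<in> level \<gamma> i \<alpha> \<beta> m"
proof -
  obtain a b where ab: "a \<in> outward i l" "b \<in> B" "z \<in> cell \<gamma> (node i l) a \<alpha> b \<beta>"
    using z(1) by (auto simp: mem_cells_iff)
  obtain a' b' where ab': "a' \<in> outward i m'" "b' \<in> inward i m'" "z \<in> cell \<gamma> (node i m') a' \<alpha> b' \<beta>"
    using z(2) by (auto simp: level_def mem_cells_iff)
  note sides = outward_side[of i] inward_side[of i]
  have sep: "node i l \<in> tree_path v b" if "v \<in> outward i l" for v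
    using sides_separated[OF outward_side B(1) B(2)[symmetric] that ab(2)] i lm by simp
  have a: "a \<in> outward i m'"
    using cells_meet[OF ab(3) ab'(3) outward_side B(1) B(2)[symmetric]
        outward_side inward_side outward_neq_inward]
      ab ab' i lm levels by simp
  then have "a \<in> outward i m" using outward_mono[OF lm(3)] by blast
  have "b \<notin> outward i l" using sides_disjoint[OF B(1) outward_side] B(2) ab(2) i lm by auto
  then have "b \<notin> outward i m" "b \<noteq> node i m"
    using outward_mono[OF lm(1)] notin_side[OF B(1)] ab(2) i lm
    by (auto simp: node_in_outward_iff le_less)
  then have b: "b \<in> inward i m" using outward_inward_cases[of i m b] i lm by auto
  have "node i m \<in> tree_path a b"
    using sides_separated[OF outward_side inward_side outward_neq_inward \<open>a \<in> outward i m\<close> b] i lm by simp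
  moreover have "node i l \<in> tree_path (node i m) b"
    using sep[of "node i m"] i lm by (cases "l = m") (auto simp: node_in_outward_iff)
  moreover have "node i m' \<in> tree_path (node i m) a"
    using node_separates[of a i m' "node i m"] a i lm separators_commute[of E a]
    by (auto simp: node_in_outward_iff)
  ultimately have "z \<in> cell \<gamma> (node i m) a \<alpha> b \<beta>"
    using cell_slide_peak[OF ab(3) sep[OF ab(1)]] cellD(1)[OF ab'(3)] levels by blast
  then show ?thesis unfolding level_def mem_cells_iff using \<open>a \<in> outward i m\<close> b by blast
qed

lemma AR_level: "\<lbrakk>i < n; 1 \<le> m; m < height i\<rbrakk> \<Longrightarrow> AR (level \<gamma> i \<alpha> \<beta> m)"
  unfolding level_def using levels by (intro AR_cells outward_side inward_side outward_neq_inward) auto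

lemma AR_tower:
  assumes "i < n"
  shows "AR (tower \<gamma> i \<alpha> \<beta>)"
proof -
  have "1 \<le> height i - 1" "{1..<height i} = {1..height i - 1}" using height_ge_2[OF assms] by auto
  moreover have "AR (\<Union>m\<in>{1..height i - 1}. level \<gamma> i \<alpha> \<beta> m)"
  proof (rule AR_UN_chain)
    show "AR (level \<gamma> i \<alpha> \<beta> m \<inter> level \<gamma> i \<alpha> \<beta> (Suc m))" if "m \<in> {1..<height i - 1}" for m
      unfolding level_def using that assms levels
      by (intro AR_cells_Int outward_side inward_side outward_neq_inward outward_mono inward_mono) auto
    show "level \<gamma> i \<alpha> \<beta> l \<inter> level \<gamma> i \<alpha> \<beta> (Suc m) \<subseteq> level \<gamma> i \<alpha> \<beta> m"
      if "1 \<le> l" "l \<le> m" "m < height i - 1" for l m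
    proof
      have "Suc m < height i" using that by simp
      moreover fix z assume "z \<in> level \<gamma> i \<alpha> \<beta> l \<inter> level \<gamma> i \<alpha> \<beta> (Suc m)"
      ultimately show "z \<in> level \<gamma> i \<alpha> \<beta> m"
        using mem_level_between[of i l m "Suc m" "inward i l"] inward_side[of i l]
          outward_neq_inward[of i l] that assms
        by (auto simp: level_def)
    qed
  qed (use calculation assms AR_level in \<open>auto simp: level_def closed_cells\<close>)
  ultimately show ?thesis by (simp add: tower_def)
qed

lemma AR_saddle: "\<lbrakk>i < n; j < n; i \<noteq> j\<rbrakk> \<Longrightarrow> AR (saddle \<gamma> i \<alpha> j \<beta>)"
  unfolding saddle_def using levels by (intro AR_cells outward_side_centre outward_neq)

lemma AR_saddle_Int_tower:
  assumes ij: "i < n" "j < n" "i \<noteq> j"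
  shows "AR (saddle \<gamma> i \<alpha> j \<beta> \<inter> tower \<gamma> i \<alpha> \<beta>)"
proof -
  have height_gt_1: "1 < height i" using height_ge_2[OF ij(1)] by simp
  have "z \<in> level \<gamma> i \<alpha> \<beta> 1" if z: "z \<in> saddle \<gamma> i \<alpha> j \<beta>" "z \<in> tower \<gamma> i \<alpha> \<beta>" for z
  proof -
    obtain m where "1 \<le> m" "m < height i" "z \<in> level \<gamma> i \<alpha> \<beta> m" using z(2) height_gt_1
      by (auto simp: tower_def)
    then show ?thesis
      using mem_level_between[of i 0 1 m "outward j 0" z] z(1) ij outward_side_centre[of j]
        outward_neq[of j i]
      by (simp add: saddle_def node_0)
  qed
  moreover have "level \<gamma> i \<alpha> \<beta> 1 \<subseteq> tower \<gamma> i \<alpha> \<beta>"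
    unfolding tower_def using height_gt_1 by (intro UN_upper) simp
  ultimately have "saddle \<gamma> i \<alpha> j \<beta> \<inter> tower \<gamma> i \<alpha> \<beta> = saddle \<gamma> i \<alpha> j \<beta> \<inter> level \<gamma> i \<alpha> \<beta> 1" by blast
  moreover have "AR (saddle \<gamma> i \<alpha> j \<beta> \<inter> level \<gamma> i \<alpha> \<beta> 1)"
    unfolding saddle_def level_def using ij levels height_gt_1
    by (intro AR_cells_Int outward_side_centre outward_neq
        outward_side inward_side outward_neq_inward
        outward_mono outward_subset_inward) auto
  ultimately show ?thesis by simp
qed

lemma AR_saddled_tower:
  assumes "i < n"
  shows "AR (saddled_tower \<gamma> i \<alpha> \<beta>)"
  unfolding saddled_tower_def
proof (rule AR_Un_UN_star)
  fix j assume j: "j \<in> {..<n} - {i}"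
  show "AR (tower \<gamma> i \<alpha> \<beta> \<inter> saddle \<gamma> i \<alpha> j \<beta>)" "AR (saddle \<gamma> i \<alpha> j \<beta>)"
    using AR_saddle_Int_tower[of i j] AR_saddle[of i j] j assms by (auto simp: Int_commute)
  show "saddle \<gamma> i \<alpha> j \<beta> \<inter> saddle \<gamma> i \<alpha> k \<beta> \<subseteq> tower \<gamma> i \<alpha> \<beta>" if k: "k \<in> {..<n} - {i}" "j \<noteq> k" for k
  proof -
    have "outward j 0 \<inter> outward k 0 \<noteq> {}" if "z \<in> saddle \<gamma> i \<alpha> j \<beta>" "z \<in> saddle \<gamma> i \<alpha> k \<beta>" for z
      using cells_Int_nonempty[OF that[unfolded saddle_def]]
        outward_side_centre outward_neq j k assms levels by simp
    then show ?thesis using outward_disjoint[of j k 0 0] j k by blast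
  qed
qed (use assms AR_tower in \<open>auto simp: closed_tower closed_saddle\<close>)

lemma saddled_towers_disjoint:
  assumes "i < n" "j < n" "i \<noteq> j"
  shows "saddled_tower \<gamma> i \<alpha> \<beta> \<inter> saddled_tower \<gamma> j \<alpha> \<beta> = {}"
proof -
  have False if z: "z \<in> saddled_tower \<gamma> i \<alpha> \<beta>" "z \<in> saddled_tower \<gamma> j \<alpha> \<beta>" for z
  proof -
    obtain p A B where AB: "A \<in> sides p" "B \<in> sides p" "A \<noteq> B" "z \<in> cells \<gamma> p A \<alpha> B \<beta>" "A \<subseteq> outward i 0"
      using saddled_towerE[OF z(1) assms(1)] .
    obtain p' A' B' where AB': "A' \<in> sides p'" "B' \<in> sides p'" "A' \<noteq> B'" "z \<in> cells \<gamma> p' A' \<alpha> B' \<beta>"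
      "A' \<subseteq> outward j 0"
      using saddled_towerE[OF z(2) assms(2)] .
    have "A \<inter> A' \<noteq> {}" using cells_Int_nonempty[OF AB(4) AB'(4) AB(1-3) AB'(1-3)] levels by simp
    then show False using AB(5) AB'(5) outward_disjoint[OF assms] by blast
  qed
  then show ?thesis by blast
qed

lemma saddle_if_peaks_on_distinct_branches:
  assumes "i < n" "j < n" "i \<noteq> j" "m \<in> {1..<height i}" "m' \<in> {1..<height j}"
    and z: "z \<in> cells \<gamma> (node i m) (outward i m) \<alpha> (inward i m) \<beta>"
      "z \<in> cells \<gamma> (node j m') (inward j m') \<alpha> (outward j m') \<beta>"
  shows "z \<in> saddle \<gamma> i \<alpha> j \<beta>"
proof -
  obtain a b where ab: "a \<in> outward i m" "b \<in> inward i m" "z \<in> cell \<gamma> (node i m) a \<alpha> b \<beta>"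
    using z(1) by (auto simp: mem_cells_iff)
  obtain a' b' where ab': "a' \<in> inward j m'" "b' \<in> outward j m'" "z \<in> cell \<gamma> (node j m') a' \<alpha> b' \<beta>"
    using z(2) by (auto simp: mem_cells_iff)
  have a': "a' \<in> outward i m"
    using cells_meet[OF ab(3) ab'(3) outward_side inward_side outward_neq_inward
        inward_side outward_side outward_neq_inward[symmetric]] ab ab' assms(1-5) levels by simp
  have wells: "a' \<in> outward i 0" "b' \<in> outward j 0" using a' ab'(2) outward_mono by blast+
  have "node j m' \<in> tree_path a' b'"
    using sides_separated[OF inward_side outward_side outward_neq_inward[symmetric] ab'(1,2)] assms(2,5)
    by simp
  moreover have "c \<in> tree_path a' b'"
    using sides_separated[OF outward_side_centre outward_side_centre outward_neq wells] assms(1-3) by simp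
  moreover have "node j m' \<in> tree_path c b'" "node i m \<in> tree_path c a'"
    using node_separates[of b' j m' c] node_separates[of a' i m c] ab'(2) a' assms(1,2) centre_notin_outward
      separators_commute[of E c] by auto
  ultimately have "z \<in> cell \<gamma> c a' \<alpha> b' \<beta>"
    using cell_slide_peak[OF ab'(3)] cellD(1)[OF ab(3)] levels by simp
  then show ?thesis using wells by (auto simp: saddle_def mem_cells_iff)
qed

lemma saddled_tower_Int_tower:
  assumes ij: "i < n" "j < n" and z: "z \<in> saddled_tower \<gamma> j \<beta> \<alpha>" "z \<in> tower \<gamma> i \<alpha> \<beta>"
  shows "i \<noteq> j \<and> z \<in> saddle \<gamma> i \<alpha> j \<beta>"
proof -
  obtain m where m: "m \<in> {1..<height i}" "z \<in> cells \<gamma> (node i m) (outward i m) \<alpha> (inward i m) \<beta>"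
    using z(2) unfolding mem_tower_iff by blast
  have sides: "outward i m \<in> sides (node i m)" "inward i m \<in> sides (node i m)" "outward i m \<noteq> inward i m"
    using m(1) ij(1) outward_side inward_side outward_neq_inward by auto
  from z(1) consider
    (tower) m' where "m' \<in> {1..<height j}" "z \<in> cells \<gamma> (node j m') (inward j m') \<alpha> (outward j m') \<beta>"
    | (saddle) k where "k < n" "k \<noteq> j" "z \<in> saddle \<gamma> k \<alpha> j \<beta>"
    unfolding saddled_tower_def Un_iff mem_tower_iff cells_commute[of _ _ _ \<beta>] saddle_commute[of _ j]
    by auto
  then show ?thesis
  proof cases
    case tower
    have "inward j m' \<in> sides (node j m')" "outward j m' \<in> sides (node j m')" "inward j m' \<noteq> outward j m'"
      using tower(1) ij(2) outward_side inward_side outward_neq_inward[of j m'] by auto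
    then have "outward i m \<inter> inward j m' \<noteq> {} \<and> inward i m \<inter> outward j m' \<noteq> {}"
      using cells_Int_nonempty[OF m(2) tower(2)] sides levels by simp
    then have "i \<noteq> j"
      using outward_Int_inward_less[of _ i m m']
        outward_Int_inward_less[of _ i m' m] tower(1) m(1) ij by fastforce
    then show ?thesis using saddle_if_peaks_on_distinct_branches[OF ij] tower m by blast
  next
    case saddle
    then have "outward i m \<inter> outward k 0 \<noteq> {}"
      using cells_Int_nonempty[OF m(2) saddle(3)[unfolded saddle_def]]
        sides outward_side_centre outward_neq levels ij
      by simp
    then have "k = i" using outward_disjoint[OF ij(1) saddle(1)] by blast
    then show ?thesis using saddle by simp
  qed
qed

end

context
  fixes \<alpha> \<beta> \<gamma> :: real
  assumes levels: "\<alpha> < \<beta>" "\<beta> < \<gamma>"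
begin

lemma data_eq_UN_towers:
  "data E {#(\<alpha>, \<infinity>), (\<beta>, ereal \<gamma>)#} = (\<Union>j<n. saddled_tower \<gamma> j \<beta> \<alpha>) \<union> (\<Union>i<n. tower \<gamma> i \<alpha> \<beta>)"
proof (intro equalityI subsetI)
  fix z assume "z \<in> data E {#(\<alpha>, \<infinity>), (\<beta>, ereal \<gamma>)#}"
  then obtain p A B where AB: "A \<in> sides p" "B \<in> sides p" "A \<noteq> B" "z \<in> cells \<gamma> p A \<alpha> B \<beta>"
    using data_iff_cells[OF levels] by blast
  show "z \<in> (\<Union>j<n. saddled_tower \<gamma> j \<beta> \<alpha>) \<union> (\<Union>i<n. tower \<gamma> i \<alpha> \<beta>)"
  proof (cases "p = c")
    case True
    then obtain i j where ij: "i < n" "A = outward i 0" "j < n" "B = outward j 0"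
      using sides_centre_cases AB(1,2) by metis
    then have "z \<in> saddle \<gamma> j \<beta> i \<alpha>" using AB(4) True cells_commute[of \<gamma> c A] by (simp add: saddle_def)
    then show ?thesis using AB(3) ij by (auto simp: saddled_tower_def)
  next
    case False
    obtain i m where im: "i < n" "m \<le> height i" "p = node i m" by (rule vertex_cases)
    then have "1 \<le> m" using False node_0 by (cases m) auto
    then have "m \<in> {1..<height i}" "A = outward i m \<and> B = inward i m \<or> A = inward i m \<and> B = outward i m"
      using sides_node_cases[of i m A B] AB(1-3) im by simp_all
    then have "z \<in> tower \<gamma> i \<alpha> \<beta> \<or> z \<in> tower \<gamma> i \<beta> \<alpha>"
      using AB(4) cells_commute[of \<gamma> p A] im(3) unfolding mem_tower_iff by metis
    then show ?thesis using im(1) by (auto simp: saddled_tower_def)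
  qed
next
  fix z assume "z \<in> (\<Union>j<n. saddled_tower \<gamma> j \<beta> \<alpha>) \<union> (\<Union>i<n. tower \<gamma> i \<alpha> \<beta>)"
  then consider j where "j < n" "z \<in> saddled_tower \<gamma> j \<beta> \<alpha>" | i where "i < n" "z \<in> saddled_tower \<gamma> i \<alpha> \<beta>"
    by (auto simp: saddled_tower_def)
  then have "\<exists>p. \<exists>A\<in>sides p. \<exists>B\<in>sides p. A \<noteq> B \<and> z \<in> cells \<gamma> p A \<alpha> B \<beta>"
    by cases (metis saddled_towerE cells_commute)+
  then show "z \<in> data E {#(\<alpha>, \<infinity>), (\<beta>, ereal \<gamma>)#}" using data_iff_cells[OF levels] by blast
qed

lemma crown_AR_cover_towers:
  "crown_AR_cover n (\<lambda>j. saddled_tower \<gamma> j \<beta> \<alpha>) (\<lambda>i. tower \<gamma> i \<alpha> \<beta>)"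
proof -
  have order: "\<alpha> \<noteq> \<beta>" "\<beta> \<noteq> \<alpha>" "\<alpha> < \<gamma>" "\<beta> < \<gamma>" using levels by auto
  have "AR (saddled_tower \<gamma> j \<beta> \<alpha> \<inter> tower \<gamma> i \<alpha> \<beta>)" if "i < n" "j < n" "i \<noteq> j" for i j
  proof -
    have "saddle \<gamma> i \<alpha> j \<beta> \<subseteq> saddled_tower \<gamma> j \<beta> \<alpha>"
      using that by (auto simp: saddled_tower_def saddle_commute[of \<gamma> i \<alpha>])
    then have "saddled_tower \<gamma> j \<beta> \<alpha> \<inter> tower \<gamma> i \<alpha> \<beta> = saddle \<gamma> i \<alpha> j \<beta> \<inter> tower \<gamma> i \<alpha> \<beta>"
      using saddled_tower_Int_tower[OF order(1,3,4) that(1,2)] by blast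
    then show ?thesis using AR_saddle_Int_tower[OF order(1,3,4)] that by simp
  qed
  moreover have "saddled_tower \<gamma> i \<beta> \<alpha> \<inter> tower \<gamma> i \<alpha> \<beta> = {}" if "i < n" for i
    using saddled_tower_Int_tower[OF order(1,3,4) that that] by blast
  moreover have "tower \<gamma> i \<alpha> \<beta> \<inter> tower \<gamma> j \<alpha> \<beta> = {}" if "i < n" "j < n" "i \<noteq> j" for i j
    using saddled_towers_disjoint[OF order(1,3,4) that] by (auto simp: saddled_tower_def)
  ultimately show ?thesis
    unfolding crown_AR_cover_def
    using AR_saddled_tower[OF order(2,4,3)] AR_tower[OF order(1,3,4)] saddled_towers_disjoint[OF order(2,4,3)]
    by (simp add: closed_tower closed_saddled_tower)
qed

theorem data_homotopy_eqv_bouquet: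
  assumes "3 \<le> n"
  shows "data E {#(\<alpha>, \<infinity>), (\<beta>, ereal \<gamma>)#} homotopy_eqv bouquet (n^2 - 3*n + 1)"
  unfolding data_eq_UN_towers
  by (rule crown_AR_cover_homotopy_eqv_bouquet[OF crown_AR_cover_towers assms])

end

end

theorem theorem8p1:
  fixes E :: "('v::finite) set set" and n :: nat
  assumes "n \<ge> 3" and "star_like_tree E n"
  shows "data E {#(0, \<infinity>), (1, 4)#} homotopy_eqv bouquet (n^2 - 3*n + 1)"
proof -
  obtain c node height where "star_tree E n c node height"
    using star_like_tree_imp_star_tree[OF assms(2)] .
  then have "data E {#(0, \<infinity>), (1, ereal 4)#} homotopy_eqv bouquet (n^2 - 3*n + 1)"
    using assms(1) by (intro star_tree.data_homotopy_eqv_bouquet) auto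
  then show ?thesis by simp
qed

end
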